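(* Let $m\geq 2$ be a positive integer and let $\mathbb{K}$ be $\mathbb{R}$ or $\mathbb{C}$. (a) If $(r,p)\in[1,2]\times[1,2)$, then there is a constant $D_{m,r,p}^{\mathbb{K}}>0$ such that $$\left(\sum_{j_1,\dots,j_m=1}^{n}\left|T(e_{j_1},\dots,e_{j_m})\right|^{r}\right)^{\frac1r}\leq D_{m,r,p}^{\mathbb{K}}\, n^{\frac{2mr+2mp-mpr-pr}{2pr}}\,\|T\|$$ for all $m$-linear forms $T:\ell_p^n\times\cdots\times\ell_p^n\to\mathbb{K}$ and all positive integers $n$. Moreover, the optimal exponent of $n$ is not smaller than $\frac{2m-r}{2r}$. (b) If $(r,p)\in(2,\infty)\times[1,m]$, then there is a constant $D_{m,r,p}^{\mathbb{K}}>0$ such that $$\left(\sum_{j_1,\dots,j_m=1}^{n}\left|T(e_{j_1},\dots,e_{j_m})\right|^{r}\right)^{\frac1r}\leq \begin{cases} D_{m,r,p}^{\mathbb{K}}\, n^{\frac{2m-p+\varepsilon}{pr}}\,\|T\| & \text{if } p>2,\\[4pt] D_{m,r,p}^{\mathbb{K}}\, n^{\frac{2m-p}{pr}}\,\|T\| & \text{if } p=2,\end{cases}$$ for all $m$-linear forms $T:\ell_p^n\times\cdots\times\ell_p^n\to\mathbb{K}$, all positive integers $n$ and all $\varepsilon>0$ (no upper estimate is asserted for $p<2$). Moreover, the optimal exponent of $n$ is not smaller than $\frac{2mr+2mp-mpr-pr}{2pr}$ if $2\leq p\leq m$, and in the case $1\leq p\leq 2$ the optimal exponent of $n$ is not smaller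 than $\frac{2m-r}{2r}$.
   Context: $\ell_p^n$ denotes $\mathbb{K}^n$ with the $\ell_p$-norm, and $e_1,\dots,e_n$ are its canonical unit vectors. For an $m$-linear form $T:\ell_p^n\times\cdots\times\ell_p^n\to\mathbb{K}$ ($m$ factors), $\|T\|=\sup\{|T(x^{(1)},\dots,x^{(m)})| : \|x^{(i)}\|_{\ell_p^n}\le 1,\ i=1,\dots,m\}$. The constants $D_{m,r,p}^{\mathbb{K}}$ depend only on $m,r,p,\mathbb{K}$ (in particular not on $n$ or $T$). "The optimal exponent of $n$ is not smaller than $t$" (for given $m,r,p,\mathbb{K}$) means: whenever $s\in\mathbb{R}$ is such that there is a constant $D>0$, independent of $n$, with $\left(\sum_{j_1,\dots,j_m=1}^{n}|T(e_{j_1},\dots,e_{j_m})|^{r}\right)^{1/r}\le D\,n^{s}\|T\|$ for all positive integers $n$ and all $m$-linear forms $T:\ell_p^n\times\cdots\times\ell_p^n\to\mathbb{K}$, then $s\ge t$. *)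

theory Defs
  imports Complex_Main "HOL-Library.FuncSet" "Jordan_Normal_Form.Matrix"
begin

text \<open>
  The space \<open>K\<^sup>n\<close> is \<^term>\<open>carrier_vec n\<close>. Indices start at 0, and an \<open>m\<close>-tuple of vectors is an
  extensional function on \<^term>\<open>{..<m}\<close>.
\<close>

type_synonym 'k mform = "(nat \<Rightarrow> 'k vec) \<Rightarrow> 'k"

definition vec_tuples :: "nat \<Rightarrow> nat \<Rightarrow> (nat \<Rightarrow> 'k vec) set" where
  "vec_tuples m n = ({..<m} \<rightarrow>\<^sub>E carrier_vec n)"

text \<open>The values of \<open>T\<close> outside \<^term>\<open>vec_tuples m n\<close> are irrelevant everywhere below.\<close>

definition multilinear_form :: "nat \<Rightarrow> nat \<Rightarrow> ('k::field) mform \<Rightarrow> bool" where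
  "multilinear_form m n T \<longleftrightarrow>
     (\<forall>x\<in>vec_tuples m n. \<forall>i<m. \<forall>u\<in>carrier_vec n. \<forall>v\<in>carrier_vec n. \<forall>c.
        T (x(i := u + v)) = T (x(i := u)) + T (x(i := v)) \<and>
        T (x(i := c \<cdot>\<^sub>v u)) = c * T (x(i := u)))"

definition lp_norm :: "real \<Rightarrow> ('k::real_normed_field) vec \<Rightarrow> real" where
  "lp_norm p v = (\<Sum>i<dim_vec v. norm (vec_index v i) powr p) powr (1 / p)"

definition form_norm :: "nat \<Rightarrow> nat \<Rightarrow> real \<Rightarrow> ('k::real_normed_field) mform \<Rightarrow> real" where
  "form_norm m n p T =
     (SUP x\<in>{x \<in> vec_tuples m n. \<forall>i<m. lp_norm p (x i) \<le> 1}. norm (T x))"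

definition coeff_norm :: "nat \<Rightarrow> nat \<Rightarrow> real \<Rightarrow> ('k::real_normed_field) mform \<Rightarrow> real" where
  "coeff_norm m n r T =
     (\<Sum>j\<in>{..<m} \<rightarrow>\<^sub>E {..<n}. norm (T (\<lambda>i\<in>{..<m}. unit_vec n (j i))) powr r) powr (1 / r)"

text \<open>The type argument \<^term>\<open>TYPE('k::real_normed_field)\<close> selects the scalar field.\<close>

definition coeff_estimate ::
    "('k::real_normed_field) itself \<Rightarrow> nat \<Rightarrow> real \<Rightarrow> real \<Rightarrow> real \<Rightarrow> real \<Rightarrow> bool" where
  "coeff_estimate _ m r p s D \<longleftrightarrow>
     (\<forall>n>0. \<forall>T :: 'k mform. multilinear_form m n T \<longrightarrow>
        coeff_norm m n r T \<le> D * real n powr s * form_norm m n p T)"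

definition optimal_exponent_ge ::
    "('k::real_normed_field) itself \<Rightarrow> nat \<Rightarrow> real \<Rightarrow> real \<Rightarrow> real \<Rightarrow> bool" where
  "optimal_exponent_ge K m r p t \<longleftrightarrow>
     (\<forall>s. (\<exists>D>0. coeff_estimate K m r p s D) \<longrightarrow> s \<ge> t)"

end

theory Submission
  imports Defs "HOL-Analysis.Convex"
begin

text \<open>
  A form is studied through its array of coefficients \<open>a\<close>. All upper estimates follow from one
  inequality, \<open>\<Sum>\<bar>a\<bar>\<^sup>2 \<le> C M\<^sup>2\<close> for a form bounded by \<open>M\<close> on the \<open>\<ell>\<^sub>2\<^sub>m\<close>-balls: compare the \<open>\<ell>\<^sub>p\<close>-
  and \<open>\<ell>\<^sub>2\<^sub>m\<close>-norms, then use Hoelder if \<open>r \<le> 2\<close> and \<open>\<bar>a\<bar> \<le> M\<close> if \<open>r > 2\<close>. To prove it, insert randomly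
  signed weights in all variables but \<open>i0\<close>, dualise in the variable \<open>i0\<close>, and bound the moments of the
  resulting Rademacher chaos from below by its second moment. The weights are the powers \<open>1/(2m)\<close> of the
  marginals of the probability density proportional to \<open>\<bar>a\<bar>\<^sup>2\<close>, and \<open>i0\<close> is an index whose marginal has
  maximal entropy.

  For the lower bounds, random signs give coefficients \<open>\<plusminus>1\<close> and a norm of order \<open>sqrt (n (1 + ln n))\<close> on
  Euclidean balls; the logarithm does not affect the exponent.
\<close>

section \<open>Rademacher chaos\<close>

text \<open>The exponent 2m is critical: the step from l_p to l_2m accounts for every power of n,
  and at p = 2m the sum of squares is bounded without any. The obstacle is that dualising in one
  variable controls only a mixed norm, l_q over that variable of a weighted l_2 norm over the
  others, with q = 2m/(2m-1) < 2 the conjugate exponent of 2m. Constant weights lose a power of n on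
  concentrated arrays. A variable fixed in advance loses one if the mass is frozen in that variable
  and spread in the others. Weights built from the marginals adapt to the mass: the inner sums then
  lose the entropies of the other variables, while the outer power q/2 < 1 gains the entropy of
  \<open>i0\<close>. Taking \<open>i0\<close> of maximal entropy makes the gain pay for the losses.

  Random signs are tested on Euclidean balls because the coefficients of a product of m vectors have
  as Euclidean norm the product of the m norms. That gives variance at most 1 at every test point;
  other values of p follow by comparing balls.\<close>

definition walsh :: "'i set \<Rightarrow> 'i set \<Rightarrow> real" where
  "walsh S A = (-1) ^ card (S \<inter> A)"

text \<open>A subset \<open>A\<close> stands for the choice of signs equal to -1 exactly on
  \<open>A\<close>, and \<open>walsh (S j) A\<close> is the product of these signs over
  \<open>S j\<close>. Expectations become averages over \<open>Pow K\<close>. The coefficients are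
  vectors so that real and complex scalars are treated together.\<close>

definition chaos :: "'j set \<Rightarrow> ('j \<Rightarrow> 'i set) \<Rightarrow> ('j \<Rightarrow> 'v::real_vector) \<Rightarrow> 'i set \<Rightarrow> 'v" where
  "chaos J S v A = (\<Sum>j\<in>J. walsh (S j) A *\<^sub>R v j)"

lemma sum_Pow_insert:
  fixes g :: "'i set \<Rightarrow> 'b::comm_monoid_add"
  assumes "finite K" "k \<notin> K"
  shows "(\<Sum>A\<in>Pow (insert k K). g A) = (\<Sum>A\<in>Pow K. g A + g (insert k A))"
proof -
  have "(\<Sum>A\<in>Pow (insert k K). g A) = (\<Sum>A\<in>Pow K. g A) + (\<Sum>A\<in>insert k ` Pow K. g A)"
    unfolding Pow_insert using assms by (intro sum.union_disjoint) auto
  also have "(\<Sum>A\<in>insert k ` Pow K. g A) = (\<Sum>A\<in>Pow K. g (insert k A))"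
    using assms(2) by (subst sum.reindex) (auto simp: inj_on_def)
  finally show ?thesis by (simp add: sum.distrib)
qed

lemma walsh_insert_notin: "k \<notin> S \<Longrightarrow> walsh S (insert k A) = walsh S A"
  by (simp add: walsh_def)

lemma walsh_remove: "k \<notin> A \<Longrightarrow> walsh (S - {k}) A = walsh S A"
proof -
  assume "k \<notin> A"
  then have "(S - {k}) \<inter> A = S \<inter> A" by blast
  then show ?thesis by (simp add: walsh_def)
qed

lemma walsh_insert_in:
  assumes "k \<in> S" "k \<notin> A" "finite A"
  shows "walsh S (insert k A) = - walsh S A"
  using assms by (simp add: walsh_def)

text \<open>Squaring |P \<plusminus> Q|^2 = |P|^2 + |Q|^2 \<plusminus> 2<P,Q> and adding cancels the
  odd terms. Cauchy-Schwarz on the remaining 8<P,Q>^2 raises the coefficient of |P|^2 |Q|^2 from 4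
  to 12.\<close>

lemma norm_sum_diff_pow4:
  fixes P Q :: "'v::real_inner"
  shows "norm (P + Q) ^ 4 + norm (P - Q) ^ 4
           \<le> 2 * norm P ^ 4 + 12 * ((norm P)\<^sup>2 * (norm Q)\<^sup>2) + 2 * norm Q ^ 4"
proof -
  have e: "norm x ^ 4 = (inner x x)\<^sup>2" "(norm x)\<^sup>2 = inner x x" for x :: 'v
    by (simp_all add: power2_norm_eq_inner[symmetric])
  have "(inner P Q)\<^sup>2 \<le> inner P P * inner Q Q" by (rule Cauchy_Schwarz_ineq)
  then show ?thesis
    unfolding e by (simp add: inner_add_left inner_add_right inner_diff_left inner_diff_right
        inner_commute[of Q P] power2_eq_square algebra_simps)
qed

lemma norm_sum_diff_pow2:
  fixes P Q :: "'v::real_inner"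
  shows "(norm (P + Q))\<^sup>2 + (norm (P - Q))\<^sup>2 = 2 * (norm P)\<^sup>2 + 2 * (norm Q)\<^sup>2"
  by (simp add: power2_norm_eq_inner inner_add_left inner_add_right inner_diff_left inner_diff_right
        inner_commute[of Q P] algebra_simps)

text \<open>Bonami's hypercontractivity argument: split off one sign.\<close>

lemma chaos_moments:
  fixes v :: "'j \<Rightarrow> 'v::real_inner"
  assumes "finite K" "finite J" "inj_on S J" "\<And>j. j \<in> J \<Longrightarrow> S j \<subseteq> K \<and> card (S j) \<le> d"
  shows "(\<Sum>A\<in>Pow K. (norm (chaos J S v A))\<^sup>2) = 2 ^ card K * (\<Sum>j\<in>J. (norm (v j))\<^sup>2) \<and>
    (\<Sum>A\<in>Pow K. norm (chaos J S v A) ^ 4) \<le> 2 ^ card K * 9 ^ d * (\<Sum>j\<in>J. (norm (v j))\<^sup>2)\<^sup>2"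
  using assms
proof (induction K arbitrary: J S d)
  case empty
  \<comment> \<open>With no signs left all \<open>S j\<close> coincide, so injectivity leaves at
    most one index.\<close>
  have S: "S j = {}" if "j \<in> J" for j using empty.prems(3)[OF that] by blast
  have "x = y" if "x \<in> J" "y \<in> J" for x y
    using inj_onD[OF empty.prems(2), of x y] S that by simp
  then consider "J = {}" | a where "J = {a}" by blast
  then show ?case
  proof cases
    case 2
    have "chaos J S v {} = v a" by (simp add: 2 chaos_def walsh_def)
    moreover have "norm (v a) ^ 4 \<le> 9 ^ d * norm (v a) ^ 4"
      using mult_right_mono[of 1 "9 ^ d" "norm (v a) ^ 4"] by simp
    ultimately show ?thesis by (simp add: 2)
  qed (simp add: chaos_def)
next
  case (insert k K)
  \<comment> \<open>\<open>P\<close> collects the terms without the sign at \<open>k\<close> and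
    \<open>Q\<close> those with it, so the chaos is \<open>P + Q\<close> or \<open>P - Q\<close>
    according to that sign. Sets in \<open>Q\<close> have lost an element, which lowers the degree
    to \<open>d - 1\<close>.\<close>
  define J0 J1 S' where "J0 = {j\<in>J. k \<notin> S j}" and "J1 = {j\<in>J. k \<in> S j}" and "S' = (\<lambda>j. S j - {k})"
  define P Q where "P = chaos J0 S v" and "Q = chaos J1 S' v"
  define p q where "p = (\<Sum>j\<in>J0. (norm (v j))\<^sup>2)" and "q = (\<Sum>j\<in>J1. (norm (v j))\<^sup>2)"
  have J: "J = J0 \<union> J1" "J0 \<inter> J1 = {}" "finite J0" "finite J1"
    using insert.prems by (auto simp: J0_def J1_def)
  have pq: "(\<Sum>j\<in>J. (norm (v j))\<^sup>2) = p + q" "p \<ge> 0" "q \<ge> 0"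
    unfolding p_def q_def using J by (simp_all add: sum.union_disjoint sum_nonneg)
  have sub: "S j \<subseteq> insert k K" "card (S j) \<le> d" "finite (S j)" if "j \<in> J" for j
    using insert.prems(3)[OF that] insert.hyps(1) by (auto intro: finite_subset)
  have fin: "finite A" "k \<notin> A" if "A \<in> Pow K" for A
    using that insert.hyps by (auto intro: finite_subset)
  have plus: "chaos J S v A = P A + Q A" if "A \<in> Pow K" for A
    unfolding chaos_def P_def Q_def J(1)
    by (subst sum.union_disjoint) (use J fin[OF that] in \<open>auto simp: S'_def walsh_remove\<close>)
  have minus: "chaos J S v (insert k A) = P A - Q A" if A: "A \<in> Pow K" for A
  proof -
    have "chaos J S v (insert k A) = (\<Sum>j\<in>J0. walsh (S j) (insert k A) *\<^sub>R v j)
        + (\<Sum>j\<in>J1. walsh (S j) (insert k A) *\<^sub>R v j)"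
      unfolding chaos_def J(1) by (subst sum.union_disjoint) (use J in auto)
    also have "(\<Sum>j\<in>J0. walsh (S j) (insert k A) *\<^sub>R v j) = P A"
      unfolding P_def chaos_def by (rule sum.cong) (auto simp: J0_def walsh_insert_notin)
    also have "(\<Sum>j\<in>J1. walsh (S j) (insert k A) *\<^sub>R v j) = - Q A"
      unfolding Q_def chaos_def sum_negf[symmetric]
      by (rule sum.cong) (use fin[OF A] in \<open>auto simp: J1_def S'_def walsh_remove walsh_insert_in\<close>)
    finally show ?thesis by simp
  qed
  have c: "card (insert k K) = Suc (card K)" using insert.hyps by simp
  define N :: real where "N = 2 ^ card K"
  have N: "N > 0" by (simp add: N_def)
  have IP: "(\<Sum>A\<in>Pow K. (norm (P A))\<^sup>2) = N * p" "(\<Sum>A\<in>Pow K. norm (P A) ^ 4) \<le> N * 9 ^ d * p\<^sup>2"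
  proof -
    have "inj_on S J0" using insert.prems(2) J(1) by (auto simp: inj_on_def)
    moreover have "S j \<subseteq> K \<and> card (S j) \<le> d" if "j \<in> J0" for j
      using that sub[of j] by (auto simp: J0_def)
    ultimately show "(\<Sum>A\<in>Pow K. (norm (P A))\<^sup>2) = N * p" 
      "(\<Sum>A\<in>Pow K. norm (P A) ^ 4) \<le> N * 9 ^ d * p\<^sup>2"
      unfolding P_def N_def p_def using insert.IH[OF J(3), of S d] by auto
  qed
  have injS': "inj_on S' J1"
  proof (rule inj_onI)
    fix x y assume "x \<in> J1" "y \<in> J1" "S' x = S' y"
    then have "S x = S y" "x \<in> J" "y \<in> J" unfolding J1_def S'_def by auto
    then show "x = y" using insert.prems(2) by (auto simp: inj_on_def)
  qed
  have cS': "S' j \<subseteq> K \<and> card (S' j) \<le> d - 1" "d > 0" if "j \<in> J1" for j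
  proof -
    have "j \<in> J" "k \<in> S j" using that by (auto simp: J1_def)
    moreover from this have "card (S j) > 0" using sub(3) by (auto simp: card_gt_0_iff)
    ultimately show "S' j \<subseteq> K \<and> card (S' j) \<le> d - 1" "d > 0"
      using sub[of j] by (auto simp: S'_def)
  qed
  have IQ: "(\<Sum>A\<in>Pow K. (norm (Q A))\<^sup>2) = N * q" 
       "(\<Sum>A\<in>Pow K. norm (Q A) ^ 4) \<le> N * 9 ^ (d - 1) * q\<^sup>2"
    unfolding Q_def N_def q_def using insert.IH[OF J(4) injS' cS'(1)] by auto
  have two: "(\<Sum>A\<in>Pow (insert k K). (norm (chaos J S v A))\<^sup>2) 
      = 2 ^ card (insert k K) * (\<Sum>j\<in>J. (norm (v j))\<^sup>2)"
  proof -
    have "(\<Sum>A\<in>Pow (insert k K). (norm (chaos J S v A))\<^sup>2)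
       = (\<Sum>A\<in>Pow K. 2 * (norm (P A))\<^sup>2 + 2 * (norm (Q A))\<^sup>2)"
      unfolding sum_Pow_insert[OF insert.hyps]
      by (intro sum.cong refl) (simp only: plus minus norm_sum_diff_pow2)
    also have "\<dots> = 2 * N * (p + q)"
      by (simp add: sum.distrib sum_distrib_left[symmetric] IP IQ algebra_simps)
    finally show ?thesis by (simp add: pq c N_def)
  qed
  have "(\<Sum>A\<in>Pow (insert k K). norm (chaos J S v A) ^ 4) \<le> 
     (\<Sum>A\<in>Pow K. 2 * norm (P A) ^ 4 + 12 * ((norm (P A))\<^sup>2 * (norm (Q A))\<^sup>2) + 2 * norm (Q A) ^ 4)"
    unfolding sum_Pow_insert[OF insert.hyps]
    by (intro sum_mono) (simp only: plus minus norm_sum_diff_pow4)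
  also have "\<dots> = 2 * (\<Sum>A\<in>Pow K. norm (P A) ^ 4) 
      + 12 * (\<Sum>A\<in>Pow K. (norm (P A))\<^sup>2 * (norm (Q A))\<^sup>2) + 2 * (\<Sum>A\<in>Pow K. norm (Q A) ^ 4)"
    by (simp add: sum.distrib sum_distrib_left)
  also have "\<dots> \<le> (2 * N) * 9 ^ d * (p + q)\<^sup>2"
  \<comment> \<open>A nonempty \<open>J1\<close> forces \<open>d > 0\<close>, so that the natural
    subtraction \<open>d - 1\<close> does not truncate.\<close>
  proof (cases "J1 = {}")
    case True
    then have "Q A = 0" for A by (simp add: Q_def chaos_def)
    moreover have "q = 0" using True by (simp add: q_def)
    ultimately show ?thesis using IP(2) by simp
  next
    case False
    then have d: "d > 0" using cS' by auto
    have nine: "(9::real) ^ d = 9 * 9 ^ (d - 1)" using d by (simp add: power_eq_if)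
    define E :: real where "E = 9 ^ (d - 1)"
    have E: "E > 0" by (simp add: E_def)
    have "(\<Sum>A\<in>Pow K. (norm (P A))\<^sup>2 * (norm (Q A))\<^sup>2)\<^sup>2 
        \<le> (\<Sum>A\<in>Pow K. ((norm (P A))\<^sup>2)\<^sup>2) * (\<Sum>A\<in>Pow K. ((norm (Q A))\<^sup>2)\<^sup>2)"
      by (rule Cauchy_Schwarz_ineq_sum)
    also have "\<dots> = (\<Sum>A\<in>Pow K. norm (P A) ^ 4) * (\<Sum>A\<in>Pow K. norm (Q A) ^ 4)"
      by simp
    also have "\<dots> \<le> (N * 9 ^ d * p\<^sup>2) * (N * 9 ^ (d - 1) * q\<^sup>2)"
      using N by (intro mult_mono IP IQ) (auto intro!: sum_nonneg)
    also have "\<dots> = (3 * N * E * p * q)\<^sup>2"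
      unfolding nine E_def[symmetric] by (simp add: power2_eq_square)
    finally have cs: "(\<Sum>A\<in>Pow K. (norm (P A))\<^sup>2 * (norm (Q A))\<^sup>2) \<le> 3 * N * E * p * q"
      by (rule power2_le_imp_le) (intro mult_nonneg_nonneg less_imp_le[OF N] less_imp_le[OF E] pq zero_le_numeral)
    \<comment> \<open>Here the base 9 is fixed: Cauchy-Schwarz puts sqrt 9 = 3 into the mixed term,
      and 12 * 3 = 36 is exactly the cross coefficient of 2 * 9 * (p + q)^2.\<close>
    have "2 * (\<Sum>A\<in>Pow K. norm (P A) ^ 4) + 12 * (\<Sum>A\<in>Pow K. (norm (P A))\<^sup>2 * (norm (Q A))\<^sup>2) 
        + 2 * (\<Sum>A\<in>Pow K. norm (Q A) ^ 4)
       \<le> 2 * (N * (9 * E) * p\<^sup>2) + 12 * (3 * N * E * p * q) + 2 * (N * E * q\<^sup>2)"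
      using IP(2) IQ(2) cs unfolding nine E_def[symmetric] by linarith
    also have "\<dots> \<le> 2 * N * (9 * E) * (p + q)\<^sup>2"
    proof -
      have "0 \<le> N * E * q\<^sup>2" using N E by simp
      then show ?thesis by (simp add: power2_eq_square algebra_simps)
    qed
    finally show ?thesis unfolding nine E_def .
  qed
  finally have "(\<Sum>A\<in>Pow (insert k K). norm (chaos J S v A) ^ 4)
     \<le> 2 ^ card (insert k K) * 9 ^ d * (\<Sum>j\<in>J. (norm (v j))\<^sup>2)\<^sup>2"
    by (simp add: pq c N_def)
  with two show ?case by blast
qed

text \<open>Trades the power \<open>q\<close> for the second and fourth powers, whose averages are
  known. Beyond \<open>R\<close> the left side is not positive; below it
  \<open>R powr (q - 2) \<le> t powr (q - 2)\<close>, because \<open>q - 2 \<le> 0\<close>.\<close>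

lemma powr_ge_quartic:
  fixes t R q :: real
  assumes "0 \<le> t" "0 < R" "q \<le> 2" "0 < q"
  shows "R powr (q - 2) * (t\<^sup>2 - t ^ 4 / R\<^sup>2) \<le> t powr q"
proof (cases "t = 0 \<or> t > R")
  case True
  then show ?thesis
  proof
    assume "t > R"
    then have "t\<^sup>2 \<ge> R\<^sup>2" using assms by (intro power_mono) auto
    then have "t\<^sup>2 * R\<^sup>2 \<le> t\<^sup>2 * t\<^sup>2" by (intro mult_left_mono) auto
    then have "t\<^sup>2 - t ^ 4 / R\<^sup>2 \<le> 0" using assms by (simp add: field_simps power_numeral_reduce)
    then have "R powr (q - 2) * (t\<^sup>2 - t ^ 4 / R\<^sup>2) \<le> 0" by (intro mult_nonneg_nonpos) auto
    also have "0 \<le> t powr q" by simp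
    finally show ?thesis .
  qed (use assms in auto)
next
  case False
  then have t: "0 < t" "t \<le> R" using assms by auto
  have "R powr (q - 2) * (t\<^sup>2 - t ^ 4 / R\<^sup>2) \<le> R powr (q - 2) * t\<^sup>2"
    by (intro mult_left_mono) auto
  also have "\<dots> \<le> t powr (q - 2) * t\<^sup>2"
    using t assms by (intro mult_right_mono powr_mono2') auto
  also have "\<dots> = t powr (q - 2) * t powr 2" using t by simp
  also have "\<dots> = t powr q" by (simp only: powr_add[symmetric]) simp
  finally show ?thesis .
qed

text \<open>The quartic inequality is averaged over the signs. As the fourth moment is at most
  \<open>9 ^ d\<close> times the square of the second, a lower bound by the second moment survives,
  with a constant depending on \<open>d\<close> and \<open>q\<close> only.\<close>

lemma chaos_powr_ge:
  fixes v :: "'j \<Rightarrow> 'v::real_inner"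
  assumes "finite K" "finite J" "inj_on S J" "\<And>j. j \<in> J \<Longrightarrow> S j \<subseteq> K \<and> card (S j) \<le> d"
    and q: "0 < q" "q \<le> 2"
  shows "2 ^ card K * ((2 * 9 ^ d) powr (q / 2 - 1) / 2 * (\<Sum>j\<in>J. (norm (v j))\<^sup>2) powr (q / 2))
    \<le> (\<Sum>A\<in>Pow K. norm (chaos J S v A) powr q)"
proof -
  define N \<sigma> :: real where "N = 2 ^ card K" and "\<sigma> = (\<Sum>j\<in>J. (norm (v j))\<^sup>2)"
  have N: "N > 0" by (simp add: N_def)
  have "\<sigma> \<ge> 0" by (simp add: \<sigma>_def sum_nonneg)
  show ?thesis
  proof (cases "\<sigma> = 0")
    case True
    then show ?thesis using q by (simp add: \<sigma>_def[symmetric] sum_nonneg)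
  next
    case False
    with \<open>\<sigma> \<ge> 0\<close> have s: "\<sigma> > 0" by simp
    define C :: real where "C = 9 ^ d"
    have C: "C > 0" by (simp add: C_def)
    \<comment> \<open>The level at which the fourth moment, at most
      \<open>N * C * \<sigma>\<^sup>2\<close>, uses up just half of the second moment
      \<open>N * \<sigma>\<close>.\<close>
    define R where "R = sqrt (2 * C * \<sigma>)"
    have R: "R > 0" "R\<^sup>2 = 2 * C * \<sigma>" using s C by (auto simp: R_def)
    note mom = chaos_moments[OF assms(1-4), of v, folded N_def \<sigma>_def C_def]
    have "N * \<sigma> - N * C * \<sigma>\<^sup>2 / R\<^sup>2 \<le> 
       (\<Sum>A\<in>Pow K. (norm (chaos J S v A))\<^sup>2) - (\<Sum>A\<in>Pow K. norm (chaos J S v A) ^ 4) / R\<^sup>2"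
      using mom R(1) by (intro diff_mono divide_right_mono) auto
    then have "R powr (q - 2) * (N * \<sigma> - N * C * \<sigma>\<^sup>2 / R\<^sup>2) \<le> 
      R powr (q - 2) * ((\<Sum>A\<in>Pow K. (norm (chaos J S v A))\<^sup>2) - (\<Sum>A\<in>Pow K. norm (chaos J S v A) ^ 4) / R\<^sup>2)"
      by (intro mult_left_mono) auto
    also have "\<dots> = (\<Sum>A\<in>Pow K. R powr (q - 2) *
        ((norm (chaos J S v A))\<^sup>2 - norm (chaos J S v A) ^ 4 / R\<^sup>2))"
      by (simp add: sum_distrib_left[symmetric] sum_subtractf sum_divide_distrib)
    also have "\<dots> \<le> (\<Sum>A\<in>Pow K. norm (chaos J S v A) powr q)"
      using R q by (intro sum_mono powr_ge_quartic) auto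
    finally have *: "R powr (q - 2) * (N * \<sigma> - N * C * \<sigma>\<^sup>2 / R\<^sup>2) 
        \<le> (\<Sum>A\<in>Pow K. norm (chaos J S v A) powr q)" .
    have "N * \<sigma> - N * C * \<sigma>\<^sup>2 / R\<^sup>2 = N * \<sigma> / 2"
      unfolding R(2) using s C by (simp add: field_simps power2_eq_square)
    moreover have "R powr (q - 2) = (2 * C) powr (q / 2 - 1) * \<sigma> powr (q / 2 - 1)"
    proof -
      have "R powr (q - 2) = (2 * C * \<sigma>) powr ((1/2) * (q - 2))"
        unfolding R_def powr_half_sqrt[symmetric, OF less_imp_le[OF mult_pos_pos[OF mult_pos_pos[OF zero_less_numeral C] s]]]
        by (simp add: powr_powr)
      also have "(1/2) * (q - 2) = q / 2 - 1" by simp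
      finally show ?thesis using s C by (simp add: powr_mult)
    qed
    moreover have "\<sigma> powr (q / 2 - 1) * \<sigma> = \<sigma> powr (q / 2)"
      using s powr_add[of \<sigma> "q/2 - 1" 1] by simp
    ultimately have "R powr (q - 2) * (N * \<sigma> - N * C * \<sigma>\<^sup>2 / R\<^sup>2) 
       = (2 * C) powr (q / 2 - 1) * \<sigma> powr (q / 2 - 1) * (N * \<sigma> / 2)" by simp
    also have "\<dots> = N * ((2 * C) powr (q / 2 - 1) / 2 * (\<sigma> powr (q / 2 - 1) * \<sigma>))" by simp
    also have "\<sigma> powr (q / 2 - 1) * \<sigma> = \<sigma> powr (q / 2)" by fact
    finally have "R powr (q - 2) * (N * \<sigma> - N * C * \<sigma>\<^sup>2 / R\<^sup>2) 
       = N * ((2 * C) powr (q / 2 - 1) / 2 * \<sigma> powr (q / 2))" .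
    with * show ?thesis unfolding N_def C_def \<sigma>_def by (simp only:)
  qed
qed

section \<open>The Hardy--Littlewood inequality\<close>

definition multi_indices :: "nat \<Rightarrow> nat \<Rightarrow> (nat \<Rightarrow> nat) set" where
  "multi_indices m n = {..<m} \<rightarrow>\<^sub>E {..<n}"

definition coeff_form ::
    "nat \<Rightarrow> nat \<Rightarrow> ((nat \<Rightarrow> nat) \<Rightarrow> 'k) \<Rightarrow> (nat \<Rightarrow> nat \<Rightarrow> 'k) \<Rightarrow> 'k::real_normed_field" where
  "coeff_form m n a x = (\<Sum>j\<in>multi_indices m n. a j * (\<Prod>i<m. x i (j i)))"

text \<open>Sums of p-th powers describe the same unit balls as \<open>lp_norm\<close> but without
  roots, and an arbitrary bound \<open>M\<close> replaces the supremum.\<close>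

definition bounded_on_lp ::
    "real \<Rightarrow> nat \<Rightarrow> nat \<Rightarrow> ((nat \<Rightarrow> nat) \<Rightarrow> 'k::real_normed_field) \<Rightarrow> real \<Rightarrow> bool" where
  "bounded_on_lp p m n a M \<longleftrightarrow>
     (\<forall>x. (\<forall>i<m. (\<Sum>l<n. norm (x i l) powr p) \<le> 1) \<longrightarrow> norm (coeff_form m n a x) \<le> M)"

lemma finite_multi_indices [simp]: "finite (multi_indices m n)"
  by (simp add: multi_indices_def finite_PiE)

lemma multi_indices_less: "j \<in> multi_indices m n \<Longrightarrow> i < m \<Longrightarrow> j i < n"
  by (auto simp: multi_indices_def)

lemma sum_multi_indices_slices:
  assumes "i < m"
  shows "(\<Sum>k<n. \<Sum>j\<in>{j\<in>multi_indices m n. j i = k}. f j) = (\<Sum>j\<in>multi_indices m n. f j)"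
  using assms by (intro sum.group) (auto simp: multi_indices_less)

text \<open>One independent sign is attached to each pair (variable, coordinate). The graph of
  \<open>j\<close> selects the m signs met by the monomial of \<open>j\<close>, and distinct
  multi-indices give distinct graphs, hence orthogonal Walsh functions.\<close>

definition graph_on :: "nat \<Rightarrow> (nat \<Rightarrow> nat) \<Rightarrow> (nat \<times> nat) set" where
  "graph_on m j = (\<lambda>i. (i, j i)) ` {..<m}"

lemma inj_on_graph_on: "inj_on (graph_on m) (multi_indices m n)"
proof (rule inj_onI)
  fix j j' assume j: "j \<in> multi_indices m n" "j' \<in> multi_indices m n" and g: "graph_on m j = graph_on m j'"
  have "j i = j' i" if "i < m" for i
  proof -
    have "(i, j i) \<in> graph_on m j'" unfolding g[symmetric] using that by (auto simp: graph_on_def)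
    then show ?thesis by (auto simp: graph_on_def)
  qed
  then show "j = j'" using j unfolding multi_indices_def by (intro PiE_ext) auto
qed

lemma card_graph_on: "card (graph_on m j) = m"
  unfolding graph_on_def by (subst card_image) (auto simp: inj_on_def)

lemma graph_on_subset: "j \<in> multi_indices m n \<Longrightarrow> graph_on m j \<subseteq> {..<m} \<times> {..<n}"
  by (auto simp: graph_on_def multi_indices_less)

lemma walsh_graph_on: "walsh (graph_on m j) A = (\<Prod>i<m. if (i, j i) \<in> A then - 1 else 1)"
proof -
  have "graph_on m j \<inter> A = (\<lambda>i. (i, j i)) ` {i\<in>{..<m}. (i, j i) \<in> A}"
    by (auto simp: graph_on_def)
  then have "card (graph_on m j \<inter> A) = card {i\<in>{..<m}. (i, j i) \<in> A}"
    by (simp add: card_image inj_on_def)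
  moreover have "(\<Prod>i<m. if (i, j i) \<in> A then - 1 else (1::real)) = (\<Prod>i\<in>{i\<in>{..<m}. (i, j i) \<in> A}. - 1)"
    by (rule prod.inter_filter[symmetric]) simp
  ultimately show ?thesis by (simp add: walsh_def)
qed

text \<open>The signs on the \<open>i0\<close> coordinate do not change the norms; they make every monomial a Walsh function
  of a set of size \<open>m\<close>.\<close>

lemma sum_slice_chaos_powr_le:
  fixes a :: "(nat \<Rightarrow> nat) \<Rightarrow> 'k::{real_normed_field, real_inner}" and w :: "nat \<Rightarrow> nat \<Rightarrow> real"
  assumes bnd: "bounded_on_lp p m n a M"
    and pq: "1 < p" "1 < q" "(q - 1) * p = q"
    and i0: "i0 < m"
    and w: "\<And>i. i < m \<Longrightarrow> (\<Sum>l<n. \<bar>w i l\<bar> powr p) \<le> 1"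
  shows "(\<Sum>k<n. norm (chaos {j\<in>multi_indices m n. j i0 = k} (graph_on m)
            (\<lambda>j. a j * of_real (\<Prod>i\<in>{..<m} - {i0}. w i (j i))) A) powr q) \<le> M powr q"
    (is "(\<Sum>k<n. norm (?X k) powr q) \<le> _")
proof -
  define X where "X = ?X"
  define T where "T = (\<Sum>k<n. norm (X k) powr q)"
  have "T \<ge> 0" by (simp add: T_def sum_nonneg)
  show ?thesis
  proof (cases "T = 0")
    case True
    then show ?thesis by (simp add: T_def X_def)
  next
    case False
    with \<open>T \<ge> 0\<close> have T: "T > 0" by simp
    define s :: "nat \<Rightarrow> nat \<Rightarrow> real" where "s i l = (if (i, l) \<in> A then - 1 else 1)" for i l
    have s1: "\<bar>s i l\<bar> = 1" for i l by (simp add: s_def)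
    \<comment> \<open>The extremal vector of Hoelder duality: \<open>y k * X k\<close> is
      \<open>norm (X k) powr q\<close> up to normalisation, and the p-th powers of \<open>y\<close>
      add up to 1. Where \<open>X k = 0\<close>, division by zero gives the wanted value 0.\<close>
    define y where "y k = of_real (norm (X k) powr q / T powr (1 / p)) / X k" for k
    define x where "x i l = (if i = i0 then of_real (s i l) * y l else of_real (s i l * w i l))" for i l
    have ny: "norm (y k) powr p = norm (X k) powr q / T" for k
    proof (cases "X k = 0")
      case False
      have "norm (y k) = norm (X k) powr q / T powr (1 / p) / norm (X k)"
        unfolding y_def norm_divide norm_of_real by (subst abs_of_nonneg) auto
      also have "\<dots> = norm (X k) powr (q - 1) / T powr (1 / p)"
        using False by (simp add: powr_diff field_simps)
      finally have "norm (y k) powr p = norm (X k) powr ((q - 1) * p) / T powr ((1 / p) * p)"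
        by (simp add: powr_divide powr_powr)
      then show ?thesis using pq T by simp
    qed (use pq in \<open>simp add: y_def\<close>)
    have "(\<Sum>l<n. norm (x i l) powr p) \<le> 1" if "i < m" for i
    proof (cases "i = i0")
      case True
      have "(\<Sum>l<n. norm (x i l) powr p) = (\<Sum>l<n. norm (X l) powr q / T)"
        unfolding x_def using True by (simp add: norm_mult s1 ny)
      also have "\<dots> = 1" using T by (simp add: sum_divide_distrib[symmetric] T_def)
      finally show ?thesis by simp
    next
      case False
      then show ?thesis using w[OF that] by (simp add: x_def norm_mult s1 abs_mult)
    qed
    then have le: "norm (coeff_form m n a x) \<le> M"
      using bnd by (auto simp: bounded_on_lp_def)
    have summand: "a j * (\<Prod>i<m. x i (j i)) = y (j i0) *
        (walsh (graph_on m j) A *\<^sub>R (a j * of_real (\<Prod>i\<in>{..<m} - {i0}. w i (j i))))" for j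
    proof -
      have "(\<Prod>i<m. x i (j i)) = x i0 (j i0) * (\<Prod>i\<in>{..<m} - {i0}. x i (j i))"
        using i0 by (intro prod.remove) auto
      also have "(\<Prod>i\<in>{..<m} - {i0}. x i (j i)) = 
          of_real (\<Prod>i\<in>{..<m} - {i0}. s i (j i)) * of_real (\<Prod>i\<in>{..<m} - {i0}. w i (j i))"
        by (simp add: x_def prod.distrib)
      also have "x i0 (j i0) = of_real (s i0 (j i0)) * y (j i0)" by (simp add: x_def)
      finally have "(\<Prod>i<m. x i (j i)) = y (j i0) * of_real (s i0 (j i0) * (\<Prod>i\<in>{..<m} - {i0}. s i (j i)))
          * of_real (\<Prod>i\<in>{..<m} - {i0}. w i (j i))" by simp
      also have "s i0 (j i0) * (\<Prod>i\<in>{..<m} - {i0}. s i (j i)) = walsh (graph_on m j) A"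
        unfolding walsh_graph_on s_def[symmetric] using i0 by (intro prod.remove[symmetric]) auto
      finally show ?thesis by (simp add: scaleR_conv_of_real)
    qed
    have "coeff_form m n a x = (\<Sum>k<n. \<Sum>j\<in>{j\<in>multi_indices m n. j i0 = k}. a j * (\<Prod>i<m. x i (j i)))"
      unfolding coeff_form_def using i0 by (rule sum_multi_indices_slices[symmetric])
    also have "\<dots> = (\<Sum>k<n. y k * X k)"
      by (simp add: summand X_def chaos_def sum_distrib_left)
    also have "\<dots> = (\<Sum>k<n. of_real (norm (X k) powr q / T powr (1 / p)))"
      using pq by (intro sum.cong) (auto simp: y_def)
    also have "\<dots> = of_real (T / T powr (1 / p))"
      by (simp add: T_def sum_divide_distrib[symmetric])
    finally have "norm (of_real (T / T powr (1 / p)) :: 'k) \<le> M" using le by simp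
    then have "T / T powr (1 / p) \<le> M" unfolding norm_of_real using T by simp
    moreover have "T / T powr (1 / p) = T powr (1 - 1 / p)" using T by (simp add: powr_diff)
    ultimately have "(T powr (1 - 1 / p)) powr q \<le> M powr q" using pq by (intro powr_mono2) auto
    moreover have "(1 - 1 / p) * q = 1" using pq by (simp add: field_simps)
    ultimately have "T \<le> M powr q" using T by (simp add: powr_powr)
    then show ?thesis by (simp add: T_def X_def)
  qed
qed

section \<open>Entropy and the choice of the distinguished variable\<close>

text \<open>A form of Jensen's inequality.\<close>

lemma weighted_exp_powr_ge:
  fixes b z :: "'j \<Rightarrow> real"
  assumes "finite J" "\<And>j. j \<in> J \<Longrightarrow> b j \<ge> 0" "sum b J > 0" "0 < \<theta>"
  shows "(\<Sum>j\<in>J. b j * (1 + \<theta> * z j)) \<le> (\<Sum>j\<in>J. b j * exp (z j)) powr \<theta> * sum b J powr (1 - \<theta>)"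
proof -
  \<comment> \<open>The tangent of the exponential at the weighted mean \<open>\<mu>\<close> of
    \<open>z\<close> yields Jensen's inequality.\<close>
  define \<beta> \<mu> where "\<beta> = sum b J" and "\<mu> = (\<Sum>j\<in>J. b j * z j) / \<beta>"
  have \<beta>: "\<beta> > 0" using assms by (simp add: \<beta>_def)
  have "\<beta> * exp \<mu> = (\<Sum>j\<in>J. b j * (1 + (z j - \<mu>))) * exp \<mu>"
  proof -
    have "(\<Sum>j\<in>J. b j * (1 + (z j - \<mu>))) = \<beta> + ((\<Sum>j\<in>J. b j * z j) - \<beta> * \<mu>)"
      by (simp add: distrib_left right_diff_distrib sum.distrib sum_subtractf sum_distrib_right \<beta>_def)
    also have "\<beta> * \<mu> = (\<Sum>j\<in>J. b j * z j)" using \<beta> by (simp add: \<mu>_def)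
    finally show ?thesis by simp
  qed
  also have "\<dots> \<le> (\<Sum>j\<in>J. b j * exp (z j - \<mu>)) * exp \<mu>"
    by (intro mult_right_mono sum_mono mult_left_mono exp_ge_add_one_self assms) auto
  also have "\<dots> = (\<Sum>j\<in>J. b j * exp (z j))"
    by (simp add: sum_distrib_right mult.assoc exp_add[symmetric])
  finally have le: "\<beta> * exp \<mu> \<le> (\<Sum>j\<in>J. b j * exp (z j))" .
  have "(\<Sum>j\<in>J. b j * (1 + \<theta> * z j)) = \<beta> + \<theta> * (\<Sum>j\<in>J. b j * z j)"
    by (simp add: distrib_left sum.distrib \<beta>_def sum_distrib_left mult.left_commute)
  also have "\<dots> = \<beta> * (1 + \<theta> * \<mu>)" using \<beta> by (simp add: \<mu>_def field_simps)
  \<comment> \<open>Giving up the exponential here makes the left side of the lemma linear in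
    \<open>z\<close>, so that it can be added over slices of different weight.\<close>
  also have "\<dots> \<le> \<beta> * exp (\<theta> * \<mu>)" using \<beta> by (intro mult_left_mono exp_ge_add_one_self) auto
  also have "\<dots> = (\<beta> * exp \<mu>) powr \<theta> * \<beta> powr (1 - \<theta>)"
  proof -
    have "(\<beta> * exp \<mu>) powr \<theta> * \<beta> powr (1 - \<theta>) = exp (\<theta> * \<mu>) * (\<beta> powr \<theta> * \<beta> powr (1 - \<theta>))"
      using \<beta> by (simp add: powr_mult exp_powr_real mult.commute mult.left_commute)
    also have "\<beta> powr \<theta> * \<beta> powr (1 - \<theta>) = \<beta>" using \<beta> by (simp flip: powr_add)
    finally show ?thesis by simp
  qed
  also have "\<dots> \<le> (\<Sum>j\<in>J. b j * exp (z j)) powr \<theta> * \<beta> powr (1 - \<theta>)"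
    using \<beta> assms(4) by (intro mult_right_mono powr_mono2 le) auto
  finally show ?thesis by (simp add: \<beta>_def)
qed

definition marginal :: "nat \<Rightarrow> nat \<Rightarrow> ((nat \<Rightarrow> nat) \<Rightarrow> real) \<Rightarrow> nat \<Rightarrow> nat \<Rightarrow> real" where
  "marginal m n b i l = (\<Sum>j\<in>{j\<in>multi_indices m n. j i = l}. b j)"

text \<open>The index \<open>i0\<close> is one whose marginal has the largest entropy.\<close>

lemma ex_slice_powr_sum_ge_1:
  assumes m: "m > 0" and b: "\<And>j. j \<in> multi_indices m n \<Longrightarrow> b j \<ge> 0" "(\<Sum>j\<in>multi_indices m n. b j) = 1"
    and \<theta>: "\<theta> = real m / (2 * real m - 1)"
  shows "\<exists>i0<m. 1 \<le> (\<Sum>k<n. (\<Sum>j\<in>{j\<in>multi_indices m n. j i0 = k}.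
           b j * (\<Prod>i\<in>{..<m} - {i0}. marginal m n b i (j i) powr (1 / real m))) powr \<theta>)"
proof -
  let ?J = "multi_indices m n" and ?\<beta> = "marginal m n b"
  \<comment> \<open>This is minus the entropy of the i-th marginal, so minimal \<open>h\<close>
    means maximal entropy.\<close>
  define h where "h i = (\<Sum>j\<in>?J. b j * ln (?\<beta> i (j i)))" for i
  obtain i0 where i0: "i0 < m" "\<And>i. i < m \<Longrightarrow> h i0 \<le> h i"
  proof -
    have "Min (h ` {..<m}) \<in> h ` {..<m}" using m by (intro Min_in) auto
    then obtain i0 where "i0 < m" "Min (h ` {..<m}) = h i0" by auto
    then show thesis using that[of i0] Min_le[of "h ` {..<m}"] by fastforce
  qed
  have \<theta>p: "\<theta> > 0" using m by (simp add: \<theta>)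
  \<comment> \<open>\<open>\<kappa>\<close> meets two demands. It satisfies
    \<open>\<kappa> * \<theta> + (1 - \<theta>) = 0\<close>, so the marginal of \<open>i0\<close>
    cancels from each slice; and it is minus the total weight (m-1)/m of the other logarithms in
    \<open>z\<close>, so the mean of \<open>z\<close> compares each \<open>h i\<close> with
    \<open>h i0\<close>.\<close>
  define \<kappa> where "\<kappa> = - (real m - 1) / real m"
  define z where "z j = (\<Sum>i\<in>{..<m} - {i0}. ln (?\<beta> i (j i))) / real m + \<kappa> * ln (?\<beta> i0 (j i0))" for j
  define V where "V j = (\<Prod>i\<in>{..<m} - {i0}. ?\<beta> i (j i) powr (1 / real m))" for j
  have \<beta>pos: "?\<beta> i (j i) > 0" if "b j > 0" "j \<in> ?J" for i j
  proof -
    have "b j \<le> ?\<beta> i (j i)" unfolding marginal_def using that b(1) by (intro member_le_sum) auto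
    then show ?thesis using that by simp
  qed
  have slice: "(\<Sum>j\<in>{j\<in>?J. j i0 = k}. b j * (1 + \<theta> * z j)) \<le> (\<Sum>j\<in>{j\<in>?J. j i0 = k}. b j * V j) powr \<theta>" for k
  proof (cases "?\<beta> i0 k = 0")
    case True
    then have "b j = 0" if "j \<in> {j\<in>?J. j i0 = k}" for j
      using that b(1) unfolding marginal_def by (subst (asm) sum_nonneg_eq_0_iff) auto
    then show ?thesis by simp
  next
    case False
    moreover have "?\<beta> i0 k \<ge> 0" unfolding marginal_def using b(1) by (intro sum_nonneg) auto
    ultimately have \<beta>: "?\<beta> i0 k > 0" by simp
    have e: "b j * exp (z j) = b j * V j * ?\<beta> i0 k powr \<kappa>" if j: "j \<in> {j\<in>?J. j i0 = k}" for j
    \<comment> \<open>Off the support of \<open>b\<close> a marginal may vanish, so logarithms are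
      exponentiated only where \<open>b j > 0\<close>.\<close>
    proof (cases "b j = 0")
      case False
      then have "b j > 0" using b(1) j by force
      then have pos: "?\<beta> i (j i) > 0" for i using \<beta>pos j by auto
      have "V j = exp ((\<Sum>i\<in>{..<m} - {i0}. ln (?\<beta> i (j i))) / real m)"
        unfolding V_def sum_divide_distrib exp_sum[OF finite_Diff[OF finite_lessThan]] powr_def
        by (rule prod.cong) (use pos in \<open>auto simp: less_imp_neq[OF pos, symmetric]\<close>)
      moreover have "?\<beta> i0 k powr \<kappa> = exp (\<kappa> * ln (?\<beta> i0 (j i0)))"
        using \<beta> j by (simp add: powr_def)
      ultimately show ?thesis by (simp add: z_def exp_add)
    qed simp
    have "(\<Sum>j\<in>{j\<in>?J. j i0 = k}. b j * (1 + \<theta> * z j)) 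
       \<le> (\<Sum>j\<in>{j\<in>?J. j i0 = k}. b j * exp (z j)) powr \<theta> * ?\<beta> i0 k powr (1 - \<theta>)"
      unfolding marginal_def
      by (rule weighted_exp_powr_ge) (use b(1) \<beta> \<theta>p in \<open>auto simp: marginal_def\<close>)
    also have "(\<Sum>j\<in>{j\<in>?J. j i0 = k}. b j * exp (z j)) = (\<Sum>j\<in>{j\<in>?J. j i0 = k}. b j * V j) * ?\<beta> i0 k powr \<kappa>"
      unfolding sum_distrib_right by (rule sum.cong) (use e in auto)
    also have "\<dots> powr \<theta> * ?\<beta> i0 k powr (1 - \<theta>) 
        = (\<Sum>j\<in>{j\<in>?J. j i0 = k}. b j * V j) powr \<theta> * (?\<beta> i0 k powr (\<kappa> * \<theta>) * ?\<beta> i0 k powr (1 - \<theta>))"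
    proof -
      have "(\<Sum>j\<in>{j\<in>?J. j i0 = k}. b j * V j) \<ge> 0" 
        unfolding V_def using b(1) by (intro sum_nonneg mult_nonneg_nonneg prod_nonneg) auto
      then show ?thesis by (simp add: powr_mult powr_powr)
    qed
    also have "?\<beta> i0 k powr (\<kappa> * \<theta>) * ?\<beta> i0 k powr (1 - \<theta>) = ?\<beta> i0 k powr (\<kappa> * \<theta> + (1 - \<theta>))"
      by (simp add: powr_add)
    also have "\<kappa> * \<theta> + (1 - \<theta>) = 0" unfolding \<kappa>_def \<theta> using m by (simp add: field_simps)
    finally show ?thesis using \<beta> by simp
  qed
  have "(\<Sum>j\<in>?J. b j * z j) = (\<Sum>i\<in>{..<m} - {i0}. h i) / real m + \<kappa> * h i0"
  proof -
    have "(\<Sum>j\<in>?J. b j * z j) = (\<Sum>j\<in>?J. (\<Sum>i\<in>{..<m} - {i0}. b j * ln (?\<beta> i (j i)))) / real m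
       + \<kappa> * (\<Sum>j\<in>?J. b j * ln (?\<beta> i0 (j i0)))"
      unfolding z_def by (simp add: distrib_left sum.distrib sum_distrib_left sum_divide_distrib mult.left_commute)
    then show ?thesis unfolding h_def by (subst (asm) sum.swap)
  qed
  \<comment> \<open>The expression is the sum of \<open>(h i - h i0) / real m\<close> over the other
    variables; here the maximal entropy of \<open>i0\<close> enters.\<close>
  also have "\<dots> \<ge> 0"
  proof -
    have "(\<Sum>i\<in>{..<m} - {i0}. h i) \<ge> (\<Sum>i\<in>{..<m} - {i0}. h i0)" using i0 by (intro sum_mono) auto
    also have "(\<Sum>i\<in>{..<m} - {i0}. h i0) = (real m - 1) * h i0" using i0 by (simp add: of_nat_diff)
    finally have "(real m - 1) * h i0 / real m \<le> (\<Sum>i\<in>{..<m} - {i0}. h i) / real m"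
      by (intro divide_right_mono) auto
    moreover have "\<kappa> * h i0 = - ((real m - 1) * h i0 / real m)"
      unfolding \<kappa>_def by (metis minus_divide_left mult_minus_left times_divide_eq_left)
    ultimately show ?thesis by linarith
  qed
  finally have nn: "(\<Sum>j\<in>?J. b j * z j) \<ge> 0" .
  have "1 \<le> 1 + \<theta> * (\<Sum>j\<in>?J. b j * z j)" using nn \<theta>p by simp
  also have "\<dots> = (\<Sum>j\<in>?J. b j * (1 + \<theta> * z j))"
    by (simp add: distrib_left sum.distrib b(2) sum_distrib_left mult.left_commute)
  also have "\<dots> = (\<Sum>k<n. \<Sum>j\<in>{j\<in>?J. j i0 = k}. b j * (1 + \<theta> * z j))"
    using i0(1) by (rule sum_multi_indices_slices[symmetric])
  also have "\<dots> \<le> (\<Sum>k<n. (\<Sum>j\<in>{j\<in>?J. j i0 = k}. b j * V j) powr \<theta>)"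
    by (intro sum_mono slice)
  finally show ?thesis using i0(1) unfolding V_def by blast
qed

text \<open>The case p = 2m of the multilinear Hardy-Littlewood inequality, where the summability
  exponent is exactly 2. The constant depends on \<open>m\<close> alone.\<close>

lemma sum_coeff_square_le:
  assumes m: "m \<ge> 2"
  shows "\<exists>C>0. \<forall>n M. \<forall>a :: (nat \<Rightarrow> nat) \<Rightarrow> 'k::{real_normed_field, real_inner}.
     bounded_on_lp (2 * real m) m n a M \<longrightarrow> (\<Sum>j\<in>multi_indices m n. (norm (a j))\<^sup>2) \<le> C * M\<^sup>2"
proof -
  \<comment> \<open>The conjugate exponent of 2m; its half is the exponent \<open>\<theta>\<close>
    of the entropy estimate.\<close>
  define q where "q = 2 * real m / (2 * real m - 1)"
  have q: "1 < q" "q \<le> 2" "(q - 1) * (2 * real m) = q" using m by (auto simp: q_def field_simps)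
  define c :: real where "c = (2 * 9 ^ m) powr (q / 2 - 1) / 2"
  have c: "c > 0" by (simp add: c_def)
  have "(\<Sum>j\<in>multi_indices m n. (norm (a j))\<^sup>2) \<le> (1 / c) powr (2 / q) * M\<^sup>2"
    if bnd: "bounded_on_lp (2 * real m) m n a M" for n M and a :: "(nat \<Rightarrow> nat) \<Rightarrow> 'k"
  proof -
    let ?J = "multi_indices m n"
    define B where "B = (\<Sum>j\<in>?J. (norm (a j))\<^sup>2)"
    have M: "M \<ge> 0"
    proof -
      have "norm (coeff_form m n a (\<lambda>i l. 0)) \<le> M" using bnd m by (auto simp: bounded_on_lp_def)
      then show ?thesis using norm_ge_zero order_trans by blast
    qed
    have "B \<ge> 0" by (simp add: B_def sum_nonneg)
    show ?thesis
    proof (cases "B = 0")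
      case True
      then show ?thesis by (simp add: B_def)
    next
      case False
      with \<open>B \<ge> 0\<close> have B: "B > 0" by simp
      define b where "b j = (norm (a j))\<^sup>2 / B" for j
      have b: "b j \<ge> 0" "(\<Sum>j\<in>?J. b j) = 1" for j
        using B by (auto simp: b_def sum_divide_distrib[symmetric] B_def[symmetric])
      have "q / 2 = real m / (2 * real m - 1)" using m by (simp add: q_def field_simps)
      from ex_slice_powr_sum_ge_1[OF _ b this] m
      obtain i0 where i0: "i0 < m" and ge: "1 \<le> (\<Sum>k<n. (\<Sum>j\<in>{j\<in>?J. j i0 = k}.
           b j * (\<Prod>i\<in>{..<m} - {i0}. marginal m n b i (j i) powr (1 / real m))) powr (q / 2))"
        by auto
      have \<beta>0: "marginal m n b i l \<ge> 0" for i l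
        unfolding marginal_def using b by (intro sum_nonneg) auto
      \<comment> \<open>The exponent fits on both sides: the 2m-th powers of the weights add up to
        the total mass 1, and their squares, which enter the second moment of the chaos, are the
        factors in the entropy estimate.\<close>
      define w where "w i l = marginal m n b i l powr (1 / (2 * real m))" for i l
      have w: "(\<Sum>l<n. \<bar>w i l\<bar> powr (2 * real m)) \<le> 1" if "i < m" for i
      proof -
        have "(\<Sum>l<n. \<bar>w i l\<bar> powr (2 * real m)) = (\<Sum>l<n. marginal m n b i l)"
          using m \<beta>0 by (simp add: w_def powr_powr)
        also have "\<dots> = 1" unfolding marginal_def sum_multi_indices_slices[OF that] by (rule b)
        finally show ?thesis by simp
      qed
      define v where "v j = a j * of_real (\<Prod>i\<in>{..<m} - {i0}. w i (j i))" for j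
      define X where "X k A = chaos {j\<in>?J. j i0 = k} (graph_on m) v A" for k A
      define K where "K = {..<m} \<times> {..<n}"
      have "finite K" by (simp add: K_def)
      have nv: "(norm (v j))\<^sup>2 = B * (b j * (\<Prod>i\<in>{..<m} - {i0}. marginal m n b i (j i) powr (1 / real m)))" for j
      proof -
        have "(w i l)\<^sup>2 = marginal m n b i l powr (1 / real m)" for i l
          unfolding w_def power2_eq_square by (simp add: powr_add[symmetric])
        then have "(\<Prod>i\<in>{..<m} - {i0}. marginal m n b i (j i) powr (1 / real m))
            = (\<Prod>i\<in>{..<m} - {i0}. w i (j i))\<^sup>2"
          by (simp only: prod_power_distrib)
        then show ?thesis
          using B by (simp add: v_def norm_mult power_mult_distrib b_def del: of_real_prod)
      qed
      have "c * B powr (q / 2) * 1 \<le> c * B powr (q / 2) * (\<Sum>k<n. (\<Sum>j\<in>{j\<in>?J. j i0 = k}.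
           b j * (\<Prod>i\<in>{..<m} - {i0}. marginal m n b i (j i) powr (1 / real m))) powr (q / 2))"
        using c by (intro mult_left_mono ge) auto
      also have "\<dots> = (\<Sum>k<n. c * (\<Sum>j\<in>{j\<in>?J. j i0 = k}. (norm (v j))\<^sup>2) powr (q / 2))"
      proof -
        have "(\<Sum>j\<in>{j\<in>?J. j i0 = k}. (norm (v j))\<^sup>2) powr (q / 2) = B powr (q / 2) *
            (\<Sum>j\<in>{j\<in>?J. j i0 = k}. b j * (\<Prod>i\<in>{..<m} - {i0}. marginal m n b i (j i) powr (1 / real m)))
              powr (q / 2)" for k
          unfolding nv sum_distrib_left[symmetric] by (rule powr_mult)
        then show ?thesis by (simp add: sum_distrib_left mult.assoc)
      qed
      finally have 1: "c * B powr (q / 2) \<le> (\<Sum>k<n. c * (\<Sum>j\<in>{j\<in>?J. j i0 = k}. (norm (v j))\<^sup>2) powr (q / 2))"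
        by simp
      have "2 ^ card K * (c * B powr (q / 2)) \<le> 
          (\<Sum>k<n. 2 ^ card K * (c * (\<Sum>j\<in>{j\<in>?J. j i0 = k}. (norm (v j))\<^sup>2) powr (q / 2)))"
        using mult_left_mono[OF 1, of "2 ^ card K"] by (simp add: sum_distrib_left)
      also have "\<dots> \<le> (\<Sum>k<n. \<Sum>A\<in>Pow K. norm (X k A) powr q)"
        unfolding c_def X_def
      proof (intro sum_mono chaos_powr_ge)
        show "inj_on (graph_on m) {j\<in>?J. j i0 = k}" for k
          by (rule inj_on_subset[OF inj_on_graph_on]) auto
      qed (use \<open>finite K\<close> graph_on_subset card_graph_on q in \<open>auto simp: K_def\<close>)
      \<comment> \<open>After the swap each choice of signs is a separate test of the form, bounded
        by \<open>M powr q\<close>, and so is the average.\<close>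
      also have "\<dots> = (\<Sum>A\<in>Pow K. \<Sum>k<n. norm (X k A) powr q)" by (rule sum.swap)
      also have "\<dots> \<le> (\<Sum>A\<in>Pow K. M powr q)"
        unfolding X_def v_def using m q i0 w bnd by (intro sum_mono sum_slice_chaos_powr_le) auto
      also have "\<dots> = 2 ^ card K * M powr q" using \<open>finite K\<close> by (simp add: card_Pow)
      finally have "c * B powr (q / 2) \<le> M powr q" by simp
      then have "B powr (q / 2) \<le> (1 / c) * M powr q" using c by (simp add: field_simps)
      then have "(B powr (q / 2)) powr (2 / q) \<le> ((1 / c) * M powr q) powr (2 / q)"
        using q by (intro powr_mono2) auto
      also have "\<dots> = (1 / c) powr (2 / q) * M powr 2"
        unfolding powr_mult powr_powr using q by simp
      also have "M powr 2 = M\<^sup>2" using M by simp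
      also have "(B powr (q / 2)) powr (2 / q) = B" using B q by (simp add: powr_powr)
      finally show ?thesis by (simp add: B_def)
    qed
  qed
  then show ?thesis using c by (intro exI[of _ "(1 / c) powr (2 / q)"]) auto
qed

section \<open>Comparison of norms, and forms versus coefficients\<close>

text \<open>Concavity of \<open>t powr \<theta>\<close>: Young's inequality is applied to each term
  against the mean \<open>S / N\<close>, the point where it is sharp for equal terms.\<close>

lemma sum_powr_le_card:
  fixes t :: "'i \<Rightarrow> real"
  assumes "finite I" "\<And>i. i \<in> I \<Longrightarrow> t i \<ge> 0" "0 < \<theta>" "\<theta> \<le> 1"
  shows "(\<Sum>i\<in>I. t i powr \<theta>) \<le> real (card I) powr (1 - \<theta>) * sum t I powr \<theta>"
proof (cases "sum t I = 0")
  case True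
  then have "t i = 0" if "i \<in> I" for i using that assms by (simp add: sum_nonneg_eq_0_iff)
  then show ?thesis by simp
next
  case False
  define S N where "S = sum t I" and "N = real (card I)"
  have S: "S > 0" using False sum_nonneg[of I t] assms(2) by (simp add: S_def)
  have "I \<noteq> {}" using False by auto
  then have N: "N > 0" using assms(1) by (simp add: N_def card_gt_0_iff)
  have "t i powr \<theta> * (S / N) powr (1 - \<theta>) \<le> \<theta> * t i + (1 - \<theta>) * (S / N)" if "i \<in> I" for i
  proof (cases "t i = 0")
    case True
    then show ?thesis using S N assms by simp
  next
    case False
    then show ?thesis
      using Youngs_inequality_0[of \<theta> "1 - \<theta>" "t i" "S / N"] assms(2)[OF that] assms(3,4) S N by simp
  qed
  then have "(\<Sum>i\<in>I. t i powr \<theta> * (S / N) powr (1 - \<theta>)) \<le> (\<Sum>i\<in>I. \<theta> * t i + (1 - \<theta>) * (S / N))"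
    by (rule sum_mono)
  also have "\<dots> = \<theta> * S + N * ((1 - \<theta>) * (S / N))"
    by (simp add: sum.distrib sum_distrib_left[symmetric] S_def N_def)
  also have "\<dots> = S" using N by (simp add: left_diff_distrib)
  finally have "(\<Sum>i\<in>I. t i powr \<theta>) * (S / N) powr (1 - \<theta>) \<le> S" by (simp add: sum_distrib_right)
  then have "(\<Sum>i\<in>I. t i powr \<theta>) \<le> S / (S / N) powr (1 - \<theta>)"
    using S N by (simp add: pos_le_divide_eq)
  also have "\<dots> = N powr (1 - \<theta>) * (S powr 1 / S powr (1 - \<theta>))"
    using S N by (simp add: powr_divide)
  also have "S powr 1 / S powr (1 - \<theta>) = S powr \<theta>" unfolding powr_diff[symmetric] by simp
  finally show ?thesis by (simp add: S_def N_def)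
qed

lemma coeff_form_scale:
  "coeff_form m n a (\<lambda>i l. c * x i l) = c ^ m * coeff_form m n a x"
  by (simp add: coeff_form_def prod.distrib sum_distrib_left mult.left_commute)

text \<open>The l_q ball divided by n^(1/p - 1/q) lies in the l_p ball, and homogeneity of degree m
  costs the m-th power of that factor. It is used from p to 2m for upper estimates and from 2 to p
  for lower ones.\<close>

lemma bounded_on_lp_increase:
  assumes bnd: "bounded_on_lp p m n a M" and n: "n > 0" and pq: "0 < p" "p \<le> q"
  shows "bounded_on_lp q m n a (real n powr (real m * (1 / p - 1 / q)) * M)"
  unfolding bounded_on_lp_def
proof (intro allI impI)
  fix x :: "nat \<Rightarrow> nat \<Rightarrow> 'a" assume x: "\<forall>i<m. (\<Sum>l<n. norm (x i l) powr q) \<le> 1"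
  define c where "c = real n powr (1 / p - 1 / q)"
  have c: "c > 0" using n by (simp add: c_def)
  have cp: "c powr p = real n powr (1 - p / q)"
    using pq by (simp add: c_def powr_powr left_diff_distrib)
  have "(\<Sum>l<n. norm (of_real (1 / c) * x i l) powr p) \<le> 1" if "i < m" for i
  proof -
    have "(\<Sum>l<n. norm (x i l) powr p) = (\<Sum>l<n. (norm (x i l) powr q) powr (p / q))"
      using pq by (simp add: powr_powr)
    also have "\<dots> \<le> real (card {..<n}) powr (1 - p / q) * (\<Sum>l<n. norm (x i l) powr q) powr (p / q)"
      using pq by (intro sum_powr_le_card) auto
    also have "\<dots> \<le> c powr p * 1 powr (p / q)"
      unfolding cp card_lessThan using x that pq by (intro mult_left_mono powr_mono2) (auto intro: sum_nonneg)
    finally have "(\<Sum>l<n. norm (x i l) powr p) \<le> c powr p" by simp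
    moreover have "norm (of_real (1 / c) * x i l) powr p = norm (x i l) powr p / c powr p" for l
      using c by (simp add: norm_mult norm_divide powr_divide)
    ultimately show ?thesis using c by (simp add: sum_divide_distrib[symmetric])
  qed
  then have "norm (coeff_form m n a (\<lambda>i l. of_real (1 / c) * x i l)) \<le> M"
    using bnd by (simp add: bounded_on_lp_def)
  then have "(1 / c) ^ m * norm (coeff_form m n a x) \<le> M"
    unfolding coeff_form_scale using c by (simp add: norm_mult norm_power norm_divide)
  then have "norm (coeff_form m n a x) \<le> c ^ m * M" using c by (simp add: field_simps)
  also have "c ^ m = real n powr (real m * (1 / p - 1 / q))"
    using c by (simp add: powr_realpow[symmetric] c_def powr_powr mult.commute)
  finally show "norm (coeff_form m n a x) \<le> real n powr (real m * (1 / p - 1 / q)) * M" .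
qed

lemma norm_le_1_if_sum_powr_le_1:
  fixes n :: nat
  assumes "(\<Sum>l<n. norm (y l) powr p) \<le> 1" "l < n" "0 < p"
  shows "norm (y l) \<le> 1"
proof (rule ccontr)
  assume "\<not> norm (y l) \<le> 1"
  then have "1 < norm (y l) powr p" using assms(3) by simp
  also have "\<dots> \<le> (\<Sum>l<n. norm (y l) powr p)" using assms(2) by (intro member_le_sum) auto
  finally show False using assms(1) by simp
qed

lemma bounded_on_lp_decrease:
  assumes bnd: "bounded_on_lp q m n a M" and pq: "0 < p" "p \<le> q"
  shows "bounded_on_lp p m n a M"
  unfolding bounded_on_lp_def
proof (intro allI impI)
  fix x :: "nat \<Rightarrow> nat \<Rightarrow> 'a" assume x: "\<forall>i<m. (\<Sum>l<n. norm (x i l) powr p) \<le> 1"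
  have "(\<Sum>l<n. norm (x i l) powr q) \<le> 1" if "i < m" for i
  proof -
    have "(\<Sum>l<n. norm (x i l) powr q) \<le> (\<Sum>l<n. norm (x i l) powr p)"
      using x that pq by (intro sum_mono powr_mono') (auto intro: norm_le_1_if_sum_powr_le_1)
    then show ?thesis using x that by force
  qed
  then show "norm (coeff_form m n a x) \<le> M" using bnd by (simp add: bounded_on_lp_def)
qed

lemma bounded_on_lp_nonneg:
  assumes "bounded_on_lp p m n a M" "0 < p" 
  shows "M \<ge> 0"
proof -
  have "norm (coeff_form m n a (\<lambda>i l. 0)) \<le> M" using assms by (auto simp: bounded_on_lp_def)
  then show ?thesis using norm_ge_zero order_trans by blast
qed

lemma prod_indicator_multi_indices:
  assumes "j \<in> multi_indices m n" "j' \<in> multi_indices m n"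
  shows "(\<Prod>i<m. if j' i = j i then 1 else (0::'b::comm_semiring_1)) = (if j' = j then 1 else 0)"
proof (cases "j' = j")
  case False
  then obtain i where "i < m" "j' i \<noteq> j i"
    using assms unfolding multi_indices_def by (metis PiE_ext lessThan_iff)
  then show ?thesis using False by (auto intro!: prod_zero)
qed simp

lemma coeff_form_unit:
  assumes "j \<in> multi_indices m n"
  shows "coeff_form m n a (\<lambda>i l. if l = j i then 1 else 0) = a j"
proof -
  have "coeff_form m n a (\<lambda>i l. if l = j i then 1 else 0) 
      = (\<Sum>j'\<in>multi_indices m n. a j' * (if j' = j then 1 else 0))"
    unfolding coeff_form_def by (intro sum.cong refl) (simp only: prod_indicator_multi_indices[OF assms])
  also have "\<dots> = a j"
    using assms by (simp add: if_distrib[of "(*) _"] cong: if_cong)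
  finally show ?thesis .
qed

lemma bounded_on_lp_coeff_le:
  assumes "bounded_on_lp p m n a M" "0 < p" "j \<in> multi_indices m n"
  shows "norm (a j) \<le> M"
proof -
  have "(\<Sum>l<n. norm (if l = j i then 1 else 0 :: 'a) powr p) \<le> 1" if "i < m" for i
  proof -
    have "(\<Sum>l<n. norm (if l = j i then 1 else 0 :: 'a) powr p) = (\<Sum>l<n. if l = j i then 1 else 0)"
      by (rule sum.cong) auto
    then show ?thesis by simp
  qed
  then have "norm (coeff_form m n a (\<lambda>i l. if l = j i then 1 else 0)) \<le> M"
    using assms(1) by (simp add: bounded_on_lp_def)
  then show ?thesis by (simp only: coeff_form_unit[OF assms(3)])
qed

section \<open>Multilinear forms and their coefficient arrays\<close>

definition form_coeff :: "nat \<Rightarrow> nat \<Rightarrow> 'k::field mform \<Rightarrow> (nat \<Rightarrow> nat) \<Rightarrow> 'k" where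
  "form_coeff m n T j = T (\<lambda>i\<in>{..<m}. unit_vec n (j i))"

lemma multilinear_expand_slot:
  fixes T :: "'k::field mform"
  assumes T: "multilinear_form m n T" and x: "x \<in> vec_tuples m n" and i: "i < m"
  shows "T x = (\<Sum>l<n. x i $ l * T (x(i := unit_vec n l)))"
proof -
  have xi: "x i \<in> carrier_vec n" using x i by (auto simp: vec_tuples_def)
  have add: "T (x(i := u + v)) = T (x(i := u)) + T (x(i := v))"
    if "u \<in> carrier_vec n" "v \<in> carrier_vec n" for u v
    using T x i that unfolding multilinear_form_def by blast
  have smult: "T (x(i := c \<cdot>\<^sub>v u)) = c * T (x(i := u))" if "u \<in> carrier_vec n" for u c
    using T x i that unfolding multilinear_form_def by blast
  \<comment> \<open>\<open>multilinear_form\<close> offers only binary additivity, so the slot is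
    filled one coordinate at a time, along truncations of \<open>x i\<close>.\<close>
  have "T (x(i := vec n (\<lambda>l. if l < k then x i $ l else 0))) = (\<Sum>l<k. x i $ l * T (x(i := unit_vec n l)))"
    if "k \<le> n" for k
    using that
  proof (induction k)
    case 0
    have "vec n (\<lambda>l. if l < 0 then x i $ l else 0) = 0 \<cdot>\<^sub>v x i" using xi by (intro eq_vecI) auto
    then show ?case using smult[OF xi, of 0] by (simp del: fun_upd_apply)
  next
    case (Suc k)
    have "vec n (\<lambda>l. if l < Suc k then x i $ l else 0)
       = vec n (\<lambda>l. if l < k then x i $ l else 0) + (x i $ k) \<cdot>\<^sub>v unit_vec n k"
      using Suc.prems by (intro eq_vecI) (auto simp: less_Suc_eq)
    then have "T (x(i := vec n (\<lambda>l. if l < Suc k then x i $ l else 0)))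
       = T (x(i := vec n (\<lambda>l. if l < k then x i $ l else 0))) + x i $ k * T (x(i := unit_vec n k))"
      by (simp add: add smult)
    then show ?case using Suc by (simp del: fun_upd_apply)
  qed
  from this[of n] have "T (x(i := vec n (\<lambda>l. if l < n then x i $ l else 0))) 
     = (\<Sum>l<n. x i $ l * T (x(i := unit_vec n l)))" by simp
  moreover have "vec n (\<lambda>l. if l < n then x i $ l else 0) = x i" using xi by (intro eq_vecI) auto
  ultimately show ?thesis by simp
qed

lemma multilinear_eq_coeff_form:
  fixes T :: "'k::real_normed_field mform"
  assumes T: "multilinear_form m n T" and x: "x \<in> vec_tuples m n"
  shows "T x = coeff_form m n (form_coeff m n T) (\<lambda>i l. x i $ l)"
proof -
  \<comment> \<open>Hybrid tuples: the first \<open>k\<close> slots already hold unit vectors, the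
    rest still come from \<open>x\<close>. The restriction keeps them extensional, as
    \<open>vec_tuples\<close> demands.\<close>
  define y where "y k j = (\<lambda>i\<in>{..<m}. if i < k then unit_vec n (j i) else x i)" for k and j :: "nat \<Rightarrow> nat"
  have xc: "x i \<in> carrier_vec n" if "i < m" for i using x that by (auto simp: vec_tuples_def)
  have yt: "y k j \<in> vec_tuples m n" for k j
    using xc by (auto simp: y_def vec_tuples_def)
  have "T x = (\<Sum>j\<in>multi_indices k n. T (y k j) * (\<Prod>i<k. x i $ j i))" if "k \<le> m" for k
    using that
  proof (induction k)
    case 0
    have "y 0 j = x" for j
    proof
      show "y 0 j i = x i" for i
        using x PiE_arb[of x "{..<m}" "\<lambda>_. carrier_vec n" i]
        by (cases "i < m") (simp_all add: y_def vec_tuples_def)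
    qed
    then show ?case by (simp add: multi_indices_def)
  next
    case (Suc k)
    then have k: "k < m" by simp
    have "T (y k j) * (\<Prod>i<k. x i $ j i) = 
        (\<Sum>l<n. T (y (Suc k) (j(k := l))) * (\<Prod>i<Suc k. x i $ (j(k := l)) i))" for j
    proof -
      have "(y k j)(k := unit_vec n l) = y (Suc k) (j(k := l))" for l
        using k by (auto simp: y_def fun_eq_iff less_Suc_eq)
      moreover have "y k j k = x k" using k by (simp add: y_def)
      ultimately have "T (y k j) = (\<Sum>l<n. x k $ l * T (y (Suc k) (j(k := l))))"
        using multilinear_expand_slot[OF T yt k, of k j] by simp
      moreover have "(\<Prod>i<Suc k. x i $ (j(k := l)) i) = (\<Prod>i<k. x i $ j i) * x k $ l" for l
        unfolding prod.lessThan_Suc by (intro arg_cong2[where f = "(*)"] prod.cong) auto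
      ultimately show ?thesis by (simp only: sum_distrib_left mult_ac)
    qed
    then have "T x = (\<Sum>j\<in>multi_indices k n. \<Sum>l<n. 
        T (y (Suc k) (j(k := l))) * (\<Prod>i<Suc k. x i $ (j(k := l)) i))"
      using Suc by simp
    also have "\<dots> = (\<Sum>(l, j)\<in>{..<n} \<times> multi_indices k n. 
        T (y (Suc k) (j(k := l))) * (\<Prod>i<Suc k. x i $ (j(k := l)) i))"
      by (subst sum.swap) (simp add: sum.cartesian_product)
    \<comment> \<open>Writing \<open>l\<close> at position \<open>k\<close> matches pairs with
      multi-indices of length \<open>Suc k\<close>; injectivity of this map permits the
      reindexing.\<close>
    also have "\<dots> = (\<Sum>j\<in>(\<lambda>(l, j). j(k := l)) ` ({..<n} \<times> multi_indices k n). 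
        T (y (Suc k) j) * (\<Prod>i<Suc k. x i $ j i))"
      unfolding multi_indices_def
      by (subst sum.reindex[OF inj_combinator]) (auto simp: case_prod_unfold)
    also have "(\<lambda>(l, j). j(k := l)) ` ({..<n} \<times> multi_indices k n) = multi_indices (Suc k) n"
      unfolding multi_indices_def lessThan_Suc PiE_insert_eq ..
    finally show ?case .
  qed
  from this[of m] have "T x = (\<Sum>j\<in>multi_indices m n. T (y m j) * (\<Prod>i<m. x i $ j i))" by simp
  also have "\<dots> = coeff_form m n (form_coeff m n T) (\<lambda>i l. x i $ l)"
    unfolding coeff_form_def form_coeff_def y_def
    by (intro sum.cong refl arg_cong2[where f = "(*)"] arg_cong[where f = T] restrict_ext) auto
  finally show ?thesis .
qed

lemma lp_norm_le_1_iff: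
  assumes "0 < p" "v \<in> carrier_vec n"
  shows "lp_norm p v \<le> 1 \<longleftrightarrow> (\<Sum>l<n. norm (v $ l) powr p) \<le> 1"
proof -
  define S where "S = (\<Sum>l<n. norm (v $ l) powr p)"
  have "S \<ge> 0" by (simp add: S_def sum_nonneg)
  then have "S powr (1 / p) \<le> 1 \<longleftrightarrow> S \<le> 1"
    using assms(1) powr_le1[of "1 / p" S] gr_one_powr[of S "1 / p"] by (cases "S \<le> 1") (auto simp: not_le)
  moreover have "lp_norm p v = S powr (1 / p)" using assms(2) by (simp add: lp_norm_def S_def)
  ultimately show ?thesis by (simp add: S_def)
qed

text \<open>A real supremum bounds its set only once that set is known to be bounded above. Entries
  of vectors in the unit ball have modulus at most 1, so the sum of the absolute coefficients is
  such a bound.\<close>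

lemma norm_le_form_norm:
  fixes T :: "'k::real_normed_field mform"
  assumes T: "multilinear_form m n T" and p: "0 < p" 
    and x: "x \<in> vec_tuples m n" "\<forall>i<m. lp_norm p (x i) \<le> 1"
  shows "norm (T x) \<le> form_norm m n p T"
  unfolding form_norm_def
proof (rule cSUP_upper)
  show "bdd_above ((\<lambda>x. norm (T x)) ` {x \<in> vec_tuples m n. \<forall>i<m. lp_norm p (x i) \<le> 1})"
  proof (rule bdd_aboveI2)
    fix x :: "nat \<Rightarrow> 'k vec" assume x: "x \<in> {x \<in> vec_tuples m n. \<forall>i<m. lp_norm p (x i) \<le> 1}"
    have le: "norm (x i $ l) \<le> 1" if "i < m" "l < n" for i l
    proof -
      have "x i \<in> carrier_vec n" using x that by (auto simp: vec_tuples_def)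
      then have "(\<Sum>l<n. norm (x i $ l) powr p) \<le> 1" using x that lp_norm_le_1_iff[OF p] by auto
      then show ?thesis by (rule norm_le_1_if_sum_powr_le_1) (use that p in auto)
    qed
    have "norm (T x) \<le> (\<Sum>j\<in>multi_indices m n. norm (form_coeff m n T j * (\<Prod>i<m. x i $ j i)))"
      using x by (subst multilinear_eq_coeff_form[OF T]) (auto simp: coeff_form_def intro: norm_sum)
    also have "\<dots> \<le> (\<Sum>j\<in>multi_indices m n. norm (form_coeff m n T j) * 1)"
      unfolding norm_mult prod_norm[symmetric]
      by (intro sum_mono mult_left_mono prod_le_1) (auto simp: le multi_indices_less)
    finally show "norm (T x) \<le> (\<Sum>j\<in>multi_indices m n. norm (form_coeff m n T j) * 1)" .
  qed
qed (use x in auto)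

lemma bounded_on_lp_form_norm:
  fixes T :: "'k::real_normed_field mform"
  assumes T: "multilinear_form m n T" and p: "0 < p" 
  shows "bounded_on_lp p m n (form_coeff m n T) (form_norm m n p T)"
  unfolding bounded_on_lp_def
proof (intro allI impI)
  fix x :: "nat \<Rightarrow> nat \<Rightarrow> 'k" assume x: "\<forall>i<m. (\<Sum>l<n. norm (x i l) powr p) \<le> 1"
  define y where "y = (\<lambda>i\<in>{..<m}. vec n (x i))"
  have y: "y \<in> vec_tuples m n" by (simp add: y_def vec_tuples_def)
  have "T y = coeff_form m n (form_coeff m n T) x"
    unfolding multilinear_eq_coeff_form[OF T y] unfolding coeff_form_def y_def
    by (intro sum.cong refl arg_cong2[where f = "(*)"] prod.cong) (auto simp: multi_indices_less)
  moreover have "norm (T y) \<le> form_norm m n p T"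
  proof (rule norm_le_form_norm[OF T p y], intro allI impI)
    fix i assume "i < m"
    then show "lp_norm p (y i) \<le> 1" using x by (subst lp_norm_le_1_iff[OF p, of _ n]) (auto simp: y_def)
  qed
  ultimately show "norm (coeff_form m n (form_coeff m n T) x) \<le> form_norm m n p T" by simp
qed

definition form_of_coeff :: "nat \<Rightarrow> nat \<Rightarrow> ((nat \<Rightarrow> nat) \<Rightarrow> 'k) \<Rightarrow> 'k::real_normed_field mform" where
  "form_of_coeff m n a x = coeff_form m n a (\<lambda>i l. x i $ l)"

lemma multilinear_form_of_coeff: "multilinear_form m n (form_of_coeff m n a)"
  unfolding multilinear_form_def
proof (intro ballI allI impI)
  fix x :: "nat \<Rightarrow> 'a vec" and i and u v :: "'a vec" and c :: 'a
  assume i: "i < m" and u: "u \<in> carrier_vec n" and v: "v \<in> carrier_vec n"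
  have split: "(\<Prod>k<m. (x(i := w)) k $ j k) = w $ j i * (\<Prod>k\<in>{..<m} - {i}. x k $ j k)" for w :: "'a vec" and j
  proof -
    have "(\<Prod>k<m. (x(i := w)) k $ j k) = (x(i := w)) i $ j i * (\<Prod>k\<in>{..<m} - {i}. (x(i := w)) k $ j k)"
      using i by (intro prod.remove) auto
    also have "(\<Prod>k\<in>{..<m} - {i}. (x(i := w)) k $ j k) = (\<Prod>k\<in>{..<m} - {i}. x k $ j k)"
      by (rule prod.cong) auto
    finally show ?thesis by simp
  qed
  have ji: "j i < n" if "j \<in> multi_indices m n" for j using that i by (simp add: multi_indices_less)
  show "form_of_coeff m n a (x(i := u + v)) = form_of_coeff m n a (x(i := u)) + form_of_coeff m n a (x(i := v)) \<and>
        form_of_coeff m n a (x(i := c \<cdot>\<^sub>v u)) = c * form_of_coeff m n a (x(i := u))"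
    unfolding form_of_coeff_def coeff_form_def split sum.distrib[symmetric] sum_distrib_left
    using u v by (intro conjI sum.cong refl) (simp_all add: ji distrib_left distrib_right mult.left_commute mult.assoc)
qed

lemma form_coeff_form_of_coeff:
  assumes "j \<in> multi_indices m n"
  shows "form_coeff m n (form_of_coeff m n a) j = a j"
proof -
  have "form_coeff m n (form_of_coeff m n a) j = coeff_form m n a (\<lambda>i l. if l = j i then 1 else 0)"
    unfolding form_coeff_def form_of_coeff_def coeff_form_def
    using assms by (intro sum.cong refl arg_cong2[where f = "(*)"] prod.cong) (auto simp: multi_indices_less)
  then show ?thesis by (simp add: coeff_form_unit[OF assms])
qed

lemma form_norm_form_of_coeff_le:
  assumes bnd: "bounded_on_lp p m n a M" and p: "0 < p" 
  shows "form_norm m n p (form_of_coeff m n a) \<le> M"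
  unfolding form_norm_def
proof (rule cSUP_least)
  have "(\<lambda>i\<in>{..<m}. 0\<^sub>v n) \<in> vec_tuples m n" by (auto simp: vec_tuples_def)
  moreover have "lp_norm p (0\<^sub>v n :: 'a vec) \<le> 1"
    using p by (simp add: lp_norm_def)
  ultimately have "(\<lambda>i\<in>{..<m}. 0\<^sub>v n) \<in> {x \<in> vec_tuples m n. \<forall>i<m. lp_norm p (x i :: 'a vec) \<le> 1}"
    by simp
  then show "{x \<in> vec_tuples m n. \<forall>i<m. lp_norm p (x i :: 'a vec) \<le> 1} \<noteq> {}" by blast
next
  fix x :: "nat \<Rightarrow> 'a vec" assume x: "x \<in> {x \<in> vec_tuples m n. \<forall>i<m. lp_norm p (x i) \<le> 1}"
  then have "(\<Sum>l<n. norm (x i $ l) powr p) \<le> 1" if "i < m" for i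
    using lp_norm_le_1_iff[OF p, of "x i" n] that by (auto simp: vec_tuples_def)
  then show "norm (form_of_coeff m n a x) \<le> M"
    using bnd by (simp add: form_of_coeff_def bounded_on_lp_def)
qed

lemma coeff_norm_eq:
  "coeff_norm m n r T = (\<Sum>j\<in>multi_indices m n. norm (form_coeff m n T j) powr r) powr (1 / r)"
  by (simp add: coeff_norm_def multi_indices_def form_coeff_def)

section \<open>Exponents of \<open>n\<close>\<close>

text \<open>Passing from p to 2m costs n^(m/p - 1/2), whose square is the factor shown. All
  dependence on \<open>p\<close> sits in that power, so \<open>C\<close> can precede
  \<open>p\<close>.\<close>

lemma sum_coeff_square_le_lp:
  assumes m: "m \<ge> 2"
  shows "\<exists>C>0. \<forall>n>0. \<forall>p M. \<forall>a :: (nat \<Rightarrow> nat) \<Rightarrow> 'k::{real_normed_field, real_inner}.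
     0 < p \<longrightarrow> p \<le> 2 * real m \<longrightarrow> bounded_on_lp p m n a M \<longrightarrow>
     (\<Sum>j\<in>multi_indices m n. (norm (a j))\<^sup>2) \<le> C * real n powr (2 * real m / p - 1) * M\<^sup>2"
proof -
  obtain C where C: "C > 0" "\<And>n M. \<And>a :: (nat \<Rightarrow> nat) \<Rightarrow> 'k. bounded_on_lp (2 * real m) m n a M \<Longrightarrow>
     (\<Sum>j\<in>multi_indices m n. (norm (a j))\<^sup>2) \<le> C * M\<^sup>2"
    using sum_coeff_square_le[OF m, where ?'k = 'k] by blast
  have "(\<Sum>j\<in>multi_indices m n. (norm (a j))\<^sup>2) \<le> C * real n powr (2 * real m / p - 1) * M\<^sup>2"
    if n: "n > 0" and p: "0 < p" "p \<le> 2 * real m" and bnd: "bounded_on_lp p m n a M"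
    for n p M and a :: "(nat \<Rightarrow> nat) \<Rightarrow> 'k"
  proof -
    have "(\<Sum>j\<in>multi_indices m n. (norm (a j))\<^sup>2) 
      \<le> C * (real n powr (real m * (1 / p - 1 / (2 * real m))) * M)\<^sup>2"
      by (rule C(2)[OF bounded_on_lp_increase[OF bnd n p]])
    also have "\<dots> = C * real n powr (2 * (real m * (1 / p - 1 / (2 * real m)))) * M\<^sup>2"
      unfolding power_mult_distrib mult_2 powr_add by (simp only: power2_eq_square mult.assoc)
    also have "2 * (real m * (1 / p - 1 / (2 * real m))) = 2 * real m / p - 1"
      using m by (simp add: right_diff_distrib)
    finally show ?thesis .
  qed
  then show ?thesis using C(1) by blast
qed

text \<open>The exponent is m(1/r - 1/2) + (m/p - 1/2): the first part is Hoelder over the n^m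
  coefficients, the second is half the exponent in the bound for the sum of squares.\<close>

lemma coeff_estimate_small_r:
  assumes m: "m \<ge> 2" and r: "0 < r" "r \<le> 2" and p: "0 < p" "p \<le> 2 * real m"
  shows "\<exists>D>0. coeff_estimate TYPE('k::{real_normed_field, real_inner}) m r p
     ((2 * real m * r + 2 * real m * p - real m * p * r - p * r) / (2 * p * r)) D"
proof -
  obtain C where C: "C > 0" "\<And>n M. \<And>a :: (nat \<Rightarrow> nat) \<Rightarrow> 'k. n > 0 \<Longrightarrow> bounded_on_lp p m n a M \<Longrightarrow>
     (\<Sum>j\<in>multi_indices m n. (norm (a j))\<^sup>2) \<le> C * real n powr (2 * real m / p - 1) * M\<^sup>2"
    using sum_coeff_square_le_lp[OF m, where ?'k = 'k] p by blast
  have "coeff_norm m n r T \<le> C powr (1 / 2) * 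
     real n powr ((2 * real m * r + 2 * real m * p - real m * p * r - p * r) / (2 * p * r)) * form_norm m n p T"
    if n: "n > 0" and T: "multilinear_form m n T" for n and T :: "'k mform"
  proof -
    define a M where "a = form_coeff m n T" and "M = form_norm m n p T"
    have bnd: "bounded_on_lp p m n a M" unfolding a_def M_def by (rule bounded_on_lp_form_norm[OF T p(1)])
    have M: "M \<ge> 0" using bounded_on_lp_nonneg[OF bnd p(1)] .
    have "(\<Sum>j\<in>multi_indices m n. norm (a j) powr r) 
        = (\<Sum>j\<in>multi_indices m n. ((norm (a j))\<^sup>2) powr (r / 2))"
    proof (rule sum.cong)
      fix j
      have "((norm (a j))\<^sup>2) powr (r / 2) = (norm (a j) powr 2) powr (r / 2)" by simp
      then show "norm (a j) powr r = ((norm (a j))\<^sup>2) powr (r / 2)" by (simp only: powr_powr) simp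
    qed simp
    also have "\<dots> \<le> real (card (multi_indices m n)) powr (1 - r / 2) *
        (\<Sum>j\<in>multi_indices m n. (norm (a j))\<^sup>2) powr (r / 2)"
      using r by (intro sum_powr_le_card) auto
    also have "\<dots> \<le> real (card (multi_indices m n)) powr (1 - r / 2) *
        (C * real n powr (2 * real m / p - 1) * M\<^sup>2) powr (r / 2)"
      using r by (intro mult_left_mono powr_mono2 C(2)[OF n bnd]) (auto intro: sum_nonneg)
    also have "real (card (multi_indices m n)) = real n powr real m"
      using n by (simp add: multi_indices_def card_PiE powr_realpow)
    finally have "coeff_norm m n r T \<le> ((real n powr real m) powr (1 - r / 2) *
        (C * real n powr (2 * real m / p - 1) * M\<^sup>2) powr (r / 2)) powr (1 / r)"
      unfolding coeff_norm_eq a_def[symmetric] using r by (intro powr_mono2) (auto intro: sum_nonneg)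
    also have "\<dots> = C powr (1 / 2) * (real n powr (real m * (1 - r / 2) * (1 / r)) * 
        real n powr ((2 * real m / p - 1) * (1 / 2))) * (M\<^sup>2) powr (1 / 2)"
      using r by (simp add: powr_mult powr_powr mult_ac)
    also have "(M\<^sup>2) powr (1 / 2) = M" using M by (simp add: powr_half_sqrt)
    also have "real n powr (real m * (1 - r / 2) * (1 / r)) * real n powr ((2 * real m / p - 1) * (1 / 2))
       = real n powr ((2 * real m * r + 2 * real m * p - real m * p * r - p * r) / (2 * p * r))"
      unfolding powr_add[symmetric] using r p by (intro arg_cong2[where f = "(powr)"]) (auto simp: field_simps)
    finally show ?thesis unfolding M_def .
  qed
  then show ?thesis using C(1) unfolding coeff_estimate_def by (intro exI[of _ "C powr (1 / 2)"]) auto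
qed

text \<open>Each coefficient satisfies |a|^r \<le> M^(r-2) |a|^2. The value
  \<open>\<epsilon> = 0\<close> is included to cover p = 2; as \<open>n\<close> is at least 1, a
  larger \<open>\<epsilon>\<close> only enlarges the right side, so \<open>D\<close> is chosen
  before it.\<close>

lemma coeff_estimate_large_r:
  assumes m: "m \<ge> 2" and r: "2 \<le> r" and p: "0 < p" "p \<le> 2 * real m"
  shows "\<exists>D>0. \<forall>\<epsilon>\<ge>0. coeff_estimate TYPE('k::{real_normed_field, real_inner}) m r p
     ((2 * real m - p + \<epsilon>) / (p * r)) D"
proof -
  obtain C where C: "C > 0" "\<And>n M. \<And>a :: (nat \<Rightarrow> nat) \<Rightarrow> 'k. n > 0 \<Longrightarrow> bounded_on_lp p m n a M \<Longrightarrow>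
     (\<Sum>j\<in>multi_indices m n. (norm (a j))\<^sup>2) \<le> C * real n powr (2 * real m / p - 1) * M\<^sup>2"
    using sum_coeff_square_le_lp[OF m, where ?'k = 'k] p by blast
  have "coeff_norm m n r T \<le> C powr (1 / r) * 
     real n powr ((2 * real m - p + \<epsilon>) / (p * r)) * form_norm m n p T"
    if \<epsilon>: "\<epsilon> \<ge> 0" and n: "n > 0" and T: "multilinear_form m n T" for \<epsilon> n and T :: "'k mform"
  proof -
    define a M where "a = form_coeff m n T" and "M = form_norm m n p T"
    have bnd: "bounded_on_lp p m n a M" unfolding a_def M_def by (rule bounded_on_lp_form_norm[OF T p(1)])
    have M: "M \<ge> 0" using bounded_on_lp_nonneg[OF bnd p(1)] .
    have "(\<Sum>j\<in>multi_indices m n. norm (a j) powr r) 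
        \<le> (\<Sum>j\<in>multi_indices m n. M powr (r - 2) * (norm (a j))\<^sup>2)"
    proof (rule sum_mono)
      fix j assume j: "j \<in> multi_indices m n"
      have "norm (a j) powr r = norm (a j) powr (r - 2) * norm (a j) powr 2"
        by (simp only: powr_add[symmetric]) simp
      also have "\<dots> \<le> M powr (r - 2) * norm (a j) powr 2"
        using r bounded_on_lp_coeff_le[OF bnd p(1) j] by (intro mult_right_mono powr_mono2) auto
      finally show "norm (a j) powr r \<le> M powr (r - 2) * (norm (a j))\<^sup>2" by simp
    qed
    also have "\<dots> \<le> M powr (r - 2) * (C * real n powr (2 * real m / p - 1) * M\<^sup>2)"
      unfolding sum_distrib_left[symmetric] by (intro mult_left_mono C(2)[OF n bnd]) auto
    also have "\<dots> = C * real n powr (2 * real m / p - 1) * (M powr (r - 2) * M powr 2)"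
      using M by simp
    also have "M powr (r - 2) * M powr 2 = M powr r" by (simp only: powr_add[symmetric]) simp
    finally have "coeff_norm m n r T \<le> (C * real n powr (2 * real m / p - 1) * M powr r) powr (1 / r)"
      unfolding coeff_norm_eq a_def[symmetric] using r by (intro powr_mono2) (auto intro: sum_nonneg)
    also have "\<dots> = C powr (1 / r) * real n powr ((2 * real m / p - 1) * (1 / r)) * M"
      using r M unfolding powr_mult powr_powr by simp
    also have "\<dots> \<le> C powr (1 / r) * real n powr ((2 * real m - p + \<epsilon>) / (p * r)) * M"
    proof (intro mult_right_mono mult_left_mono powr_mono)
      have "(2 * real m / p - 1) * (1 / r) = (2 * real m - p) / (p * r)"
        using p r by (simp add: field_simps)
      also have "\<dots> \<le> (2 * real m - p + \<epsilon>) / (p * r)"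
        using p r \<epsilon> by (intro divide_right_mono) auto
      finally show "(2 * real m / p - 1) * (1 / r) \<le> (2 * real m - p + \<epsilon>) / (p * r)" .
    qed (use M n in auto)
    finally show ?thesis unfolding M_def .
  qed
  then show ?thesis using C(1) unfolding coeff_estimate_def by (intro exI[of _ "C powr (1 / r)"]) auto
qed

text \<open>If the gap \<open>\<delta>\<close> = t - 1/2 - s were positive, squaring would bound
  n^(2\<delta>) by a multiple of 1 + ln n. Since ln n \<le> n^\<delta> / \<delta>, the power
  n^\<delta> would stay bounded.\<close>

lemma exponent_ge_of_powr_le_ln:
  assumes le: "\<And>n. n > 0 \<Longrightarrow> real n powr t \<le> K * real n powr s * sqrt (real n * (1 + ln (real n)))"
  shows "t - 1 / 2 \<le> s"
proof (rule ccontr)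
  assume neg: "\<not> t - 1 / 2 \<le> s"
  define \<delta> where "\<delta> = t - 1 / 2 - s"
  have \<delta>: "\<delta> > 0" using neg by (simp add: \<delta>_def)
  have "real n powr \<delta> \<le> K\<^sup>2 * (1 + 1 / \<delta>)" if n: "n > 0" for n
  proof -
    have ln: "ln (real n) \<ge> 0" using n by simp
    have "real n powr \<delta> * (real n powr s * sqrt (real n)) = real n powr (\<delta> + s + 1 / 2)"
      by (simp add: powr_add powr_half_sqrt mult.assoc)
    also have "\<delta> + s + 1 / 2 = t" by (simp add: \<delta>_def)
    also have "real n powr t \<le> K * sqrt (1 + ln (real n)) * (real n powr s * sqrt (real n))"
      using le[OF n] by (simp add: real_sqrt_mult mult_ac)
    finally have "real n powr \<delta> \<le> K * sqrt (1 + ln (real n))" using n by simp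
    then have "(real n powr \<delta>)\<^sup>2 \<le> (K * sqrt (1 + ln (real n)))\<^sup>2" by (intro power_mono) auto
    also have "\<dots> = K\<^sup>2 * (1 + ln (real n))" using ln by (simp add: power_mult_distrib)
    also have "\<dots> \<le> K\<^sup>2 * (real n powr \<delta> + real n powr \<delta> / \<delta>)"
      using n \<delta> by (intro mult_left_mono add_mono ln_powr_bound ge_one_powr_ge_zero) auto
    also have "\<dots> = K\<^sup>2 * (1 + 1 / \<delta>) * real n powr \<delta>" by (simp add: algebra_simps)
    finally show ?thesis using n by (simp add: power2_eq_square)
  qed
  note bound = this
  define B where "B = K\<^sup>2 * (1 + 1 / \<delta>)"
  have B: "B \<ge> 0" using \<delta> by (simp add: B_def)
  obtain n where n: "(B + 1) powr (1 / \<delta>) \<le> real n" using real_arch_simple by blast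
  then have "n > 0" using B by (intro Suc_leI gr0I) (auto simp: not_less)
  have "B + 1 = ((B + 1) powr (1 / \<delta>)) powr \<delta>" using B \<delta> by (simp add: powr_powr)
  also have "\<dots> \<le> real n powr \<delta>" using n \<delta> by (intro powr_mono2) auto
  also have "\<dots> \<le> B" using bound[OF \<open>n > 0\<close>] by (simp add: B_def)
  finally show False by simp
qed

text \<open>Coefficients of modulus 1 make the coefficient norm exactly n^(m/r), to be compared with
  a form norm of order n^(u + 1/2) up to a logarithm. The parameter \<open>u\<close> records the
  cost of leaving the Euclidean ball.\<close>

lemma optimal_exponent_ge_of_flat_forms:
  assumes ex: "\<And>n. n > 0 \<Longrightarrow> \<exists>a :: (nat \<Rightarrow> nat) \<Rightarrow> 'k::real_normed_field. (\<forall>j. norm (a j) = 1) \<and>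
      bounded_on_lp p m n a (C * real n powr u * sqrt (real n * (1 + ln (real n))))"
    and r: "0 < r" and p: "0 < p"
  shows "optimal_exponent_ge TYPE('k) m r p (real m / r - u - 1 / 2)"
  unfolding optimal_exponent_ge_def
proof (intro allI impI)
  fix s assume "\<exists>D>0. coeff_estimate TYPE('k) m r p s D"
  then obtain D where D: "D > 0" "coeff_estimate TYPE('k) m r p s D" by blast
  have "real n powr (real m / r) \<le> (D * C) * real n powr (s + u) * sqrt (real n * (1 + ln (real n)))"
    if n: "n > 0" for n
  proof -
    obtain a :: "(nat \<Rightarrow> nat) \<Rightarrow> 'k" where a: "\<And>j. norm (a j) = 1"
      and bnd: "bounded_on_lp p m n a (C * real n powr u * sqrt (real n * (1 + ln (real n))))"
      using ex[OF n] by blast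
    have "real n powr (real m / r) = coeff_norm m n r (form_of_coeff m n a)"
      using n r by (simp add: coeff_norm_eq form_coeff_form_of_coeff a multi_indices_def[of m n] card_PiE 
          form_coeff_form_of_coeff[unfolded multi_indices_def] powr_powr flip: powr_realpow)
    also have "\<dots> \<le> D * real n powr s * form_norm m n p (form_of_coeff m n a)"
      using D(2) n multilinear_form_of_coeff[of m n a] unfolding coeff_estimate_def by blast
    also have "\<dots> \<le> D * real n powr s * (C * real n powr u * sqrt (real n * (1 + ln (real n))))"
      using D(1) by (intro mult_left_mono form_norm_form_of_coeff_le[OF bnd p]) auto
    finally show ?thesis by (simp add: powr_add mult_ac)
  qed
  then have "real m / r - 1 / 2 \<le> s + u" by (rule exponent_ge_of_powr_le_ln)
  then show "s \<ge> real m / r - u - 1 / 2" by simp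
qed

text \<open>For p \<le> 2 the ball lies in the Euclidean one and u = 0; for p \<ge> 2 the larger
  ball costs u = m(1/2 - 1/p). The two exponents agree at p = 2.\<close>

lemma optimal_exponent_ge_of_euclidean_bound:
  assumes ex: "\<And>n. n > 0 \<Longrightarrow> \<exists>a :: (nat \<Rightarrow> nat) \<Rightarrow> 'k::real_normed_field. (\<forall>j. norm (a j) = 1) \<and>
      bounded_on_lp 2 m n a (C * sqrt (real n * (1 + ln (real n))))"
    and r: "0 < r" and p: "0 < p"
  shows "p \<le> 2 \<Longrightarrow> optimal_exponent_ge TYPE('k) m r p ((2 * real m - r) / (2 * r))"
    and "2 \<le> p \<Longrightarrow> optimal_exponent_ge TYPE('k) m r p
      ((2 * real m * r + 2 * real m * p - real m * p * r - p * r) / (2 * p * r))"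
proof -
  assume p2: "p \<le> 2"
  have "optimal_exponent_ge TYPE('k) m r p (real m / r - 0 - 1 / 2)"
  proof (rule optimal_exponent_ge_of_flat_forms[OF _ r p])
    fix n :: nat assume n: "n > 0"
    from ex[OF n] bounded_on_lp_decrease[OF _ p p2] n
    show "\<exists>a :: (nat \<Rightarrow> nat) \<Rightarrow> 'k. (\<forall>j. norm (a j) = 1) \<and>
      bounded_on_lp p m n a (C * real n powr 0 * sqrt (real n * (1 + ln (real n))))" by fastforce
  qed
  also have "real m / r - 0 - 1 / 2 = (2 * real m - r) / (2 * r)" using r by (simp add: field_simps)
  finally show "optimal_exponent_ge TYPE('k) m r p ((2 * real m - r) / (2 * r))" .
next
  assume p2: "2 \<le> p"
  have "optimal_exponent_ge TYPE('k) m r p (real m / r - real m * (1 / 2 - 1 / p) - 1 / 2)"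
  proof (rule optimal_exponent_ge_of_flat_forms[OF _ r p])
    fix n :: nat assume n: "n > 0"
    from ex[OF n] obtain a :: "(nat \<Rightarrow> nat) \<Rightarrow> 'k" where a: "\<forall>j. norm (a j) = 1" and
      "bounded_on_lp 2 m n a (C * sqrt (real n * (1 + ln (real n))))" by blast
    from bounded_on_lp_increase[OF this(2) n _ p2] a
    show "\<exists>a :: (nat \<Rightarrow> nat) \<Rightarrow> 'k. (\<forall>j. norm (a j) = 1) \<and> bounded_on_lp p m n a
       (C * real n powr (real m * (1 / 2 - 1 / p)) * sqrt (real n * (1 + ln (real n))))"
      by (intro exI[of _ a]) (simp add: mult_ac)
  qed
  also have "real m / r - real m * (1 / 2 - 1 / p) - 1 / 2 = 
      (2 * real m * r + 2 * real m * p - real m * p * r - p * r) / (2 * p * r)"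
    using r p by (simp add: field_simps)
  finally show "optimal_exponent_ge TYPE('k) m r p
      ((2 * real m * r + 2 * real m * p - real m * p * r - p * r) / (2 * p * r))" .
qed

section \<open>Random forms with small norm\<close>

text \<open>For 0 \<le> y \<le> 1 quadratic upper bounds of exp y and exp (-y) are added and the
  linear terms cancel; for larger y simply y \<le> y^2. The sharper exp (x^2 / 2) would improve
  constants only.\<close>

lemma exp_plus_exp_minus_le: "exp x + exp (- x) \<le> 2 * exp (x\<^sup>2)" for x :: real
proof -
  have *: "exp y + exp (- y) \<le> 2 * exp (y\<^sup>2)" if y: "y \<ge> 0" for y :: real
  proof (cases "y \<le> 1")
    case True
    have "exp (- y) \<le> 1 / (1 + y)"
      using y exp_ge_add_one_self[of y] by (simp add: exp_minus field_simps)
    also have "\<dots> \<le> 1 - y + y\<^sup>2"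
    proof -
      have "1 \<le> (1 - y + y\<^sup>2) * (1 + y)" using y by (simp add: power2_eq_square algebra_simps)
      then show ?thesis using y by (simp add: pos_divide_le_eq)
    qed
    finally have "exp (- y) \<le> 1 - y + y\<^sup>2" .
    moreover have "exp y \<le> 1 + y + y\<^sup>2" using y True by (rule exp_bound)
    moreover have "1 + y\<^sup>2 \<le> exp (y\<^sup>2)" by (rule exp_ge_add_one_self)
    ultimately show ?thesis by linarith
  next
    case False
    then have "y \<le> y\<^sup>2" by (simp add: power2_eq_square)
    then have "exp y \<le> exp (y\<^sup>2)" by simp
    moreover have "exp (- y) \<le> exp y" using y by simp
    ultimately show ?thesis by linarith
  qed
  show ?thesis using *[of x] *[of "- x"] by (cases "x \<ge> 0") auto
qed

definition sign_in :: "'j set \<Rightarrow> 'j \<Rightarrow> real" where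
  "sign_in A j = (if j \<in> A then - 1 else 1)"

lemma sum_exp_signs_le:
  assumes "finite J"
  shows "(\<Sum>A\<in>Pow J. exp (\<Sum>j\<in>J. sign_in A j * c j)) \<le> 2 ^ card J * exp (\<Sum>j\<in>J. (c j)\<^sup>2)"
  using assms
proof (induction J)
  case (insert k J)
  define E where "E A = exp (\<Sum>j\<in>J. sign_in A j * c j)" for A
  have E: "E (insert k A) = E A" for A
    unfolding E_def using insert.hyps by (intro arg_cong[where f = exp] sum.cong) (auto simp: sign_in_def)
  have "(\<Sum>A\<in>Pow (insert k J). exp (\<Sum>j\<in>insert k J. sign_in A j * c j)) 
      = (\<Sum>A\<in>Pow (insert k J). exp (sign_in A k * c k) * E A)"
    using insert.hyps by (simp add: exp_add E_def)
  also have "\<dots> = (\<Sum>A\<in>Pow J. exp (sign_in A k * c k) * E A + exp (sign_in (insert k A) k * c k) * E (insert k A))"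
    by (rule sum_Pow_insert[OF insert.hyps])
  also have "\<dots> = (\<Sum>A\<in>Pow J. (exp (c k) + exp (- c k)) * E A)"
  proof (rule sum.cong)
    fix A assume "A \<in> Pow J"
    then have "k \<notin> A" using insert.hyps by auto
    then show "exp (sign_in A k * c k) * E A + exp (sign_in (insert k A) k * c k) * E (insert k A)
       = (exp (c k) + exp (- c k)) * E A" by (simp add: E sign_in_def distrib_right)
  qed simp
  also have "\<dots> = (exp (c k) + exp (- c k)) * (\<Sum>A\<in>Pow J. E A)" by (rule sum_distrib_left[symmetric])
  also have "\<dots> \<le> (2 * exp ((c k)\<^sup>2)) * (2 ^ card J * exp (\<Sum>j\<in>J. (c j)\<^sup>2))"
    using insert.IH unfolding E_def by (intro mult_mono exp_plus_exp_minus_le) (auto intro: sum_nonneg)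
  also have "\<dots> = 2 ^ card (insert k J) * exp (\<Sum>j\<in>insert k J. (c j)\<^sup>2)"
    using insert.hyps by (simp add: exp_add)
  finally show ?case .
qed simp

text \<open>Chernoff's method with a union bound: some choice of signs has at most the average value
  of the summed exponentials, and each exponential is at most that sum.\<close>

lemma ex_signs_small:
  fixes c :: "'z \<Rightarrow> 'j \<Rightarrow> real"
  assumes "finite J" "finite Z" and c: "\<And>z. z \<in> Z \<Longrightarrow> (\<Sum>j\<in>J. (c z j)\<^sup>2) \<le> 1"
    and L: "L > 0" "real (card Z) \<le> exp L"
  shows "\<exists>A\<subseteq>J. \<forall>z\<in>Z. (\<Sum>j\<in>J. sign_in A j * c z j) \<le> 2 * sqrt L"
proof -
  \<comment> \<open>This parameter balances both contributions: each point has mean at most exp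
    (l^2) = exp L and there are at most exp L points, so taking logarithms of exp (2 L) and dividing
    by \<open>l\<close> leaves 2 l.\<close>
  define l where "l = sqrt L"
  have l: "l > 0" "l\<^sup>2 = L" using L by (auto simp: l_def)
  define g where "g A z = exp (\<Sum>j\<in>J. sign_in A j * (l * c z j))" for A z
  have "(\<Sum>A\<in>Pow J. \<Sum>z\<in>Z. g A z) = (\<Sum>z\<in>Z. \<Sum>A\<in>Pow J. g A z)" by (rule sum.swap)
  also have "\<dots> \<le> (\<Sum>z\<in>Z. 2 ^ card J * exp L)"
  proof (rule sum_mono)
    fix z assume "z \<in> Z"
    have "(\<Sum>A\<in>Pow J. g A z) \<le> 2 ^ card J * exp (\<Sum>j\<in>J. (l * c z j)\<^sup>2)"
      unfolding g_def by (rule sum_exp_signs_le[OF assms(1)])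
    also have "(\<Sum>j\<in>J. (l * c z j)\<^sup>2) = L * (\<Sum>j\<in>J. (c z j)\<^sup>2)"
      by (simp add: power_mult_distrib l sum_distrib_left)
    also have "2 ^ card J * exp (L * (\<Sum>j\<in>J. (c z j)\<^sup>2)) \<le> 2 ^ card J * exp (L * 1)"
      using c[OF \<open>z \<in> Z\<close>] L by simp
    finally show "(\<Sum>A\<in>Pow J. g A z) \<le> 2 ^ card J * exp L" by simp
  qed
  also have "\<dots> = 2 ^ card J * (real (card Z) * exp L)" by simp
  also have "\<dots> \<le> 2 ^ card J * (exp L * exp L)" using L by (intro mult_left_mono mult_right_mono) auto
  also have "\<dots> = (\<Sum>A\<in>Pow J. exp (2 * L))" 
    using assms(1) exp_add[of L L] by (simp add: card_Pow)
  finally have le: "(\<Sum>A\<in>Pow J. \<Sum>z\<in>Z. g A z) \<le> (\<Sum>A\<in>Pow J. exp (2 * L))" .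
  have "\<exists>A\<in>Pow J. (\<Sum>z\<in>Z. g A z) \<le> exp (2 * L)"
  proof (rule ccontr)
    assume "\<not> ?thesis"
    then have "(\<Sum>A\<in>Pow J. exp (2 * L)) < (\<Sum>A\<in>Pow J. \<Sum>z\<in>Z. g A z)"
      using assms(1) by (intro sum_strict_mono) (auto simp: not_le)
    with le show False by simp
  qed
  then obtain A where A: "A \<subseteq> J" "(\<Sum>z\<in>Z. g A z) \<le> exp (2 * L)" by auto
  have "(\<Sum>j\<in>J. sign_in A j * c z j) \<le> 2 * sqrt L" if z: "z \<in> Z" for z
  proof -
    have "g A z \<le> (\<Sum>z\<in>Z. g A z)" using z assms(2) by (intro member_le_sum) (auto simp: g_def)
    also note A(2)
    finally have "(\<Sum>j\<in>J. sign_in A j * (l * c z j)) \<le> 2 * L" by (simp add: g_def)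
    also have "(\<Sum>j\<in>J. sign_in A j * (l * c z j)) = l * (\<Sum>j\<in>J. sign_in A j * c z j)"
      by (simp add: sum_distrib_left mult.left_commute)
    also have "2 * L = l * (2 * l)" using l(2) by (simp add: power2_eq_square)
    finally show ?thesis using l(1) by (simp add: l_def)
  qed
  with A(1) show ?thesis by blast
qed

section \<open>A finite net for the union bound\<close>

definition grid :: "nat \<Rightarrow> complex set" where
  "grid Q = (\<lambda>(u, v). Complex (of_int u / real Q) (of_int v / real Q)) ` ({- int Q..int Q} \<times> {- int Q..int Q})"

lemma finite_grid [simp]: "finite (grid Q)"
  by (simp add: grid_def)

lemma card_grid_le: "Q > 0 \<Longrightarrow> card (grid Q) \<le> (3 * Q)\<^sup>2"
proof -
  assume Q: "Q > 0"
  have "card (grid Q) \<le> card ({- int Q..int Q} \<times> {- int Q..int Q})"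
    unfolding grid_def by (rule card_image_le) auto
  also have "\<dots> = (2 * Q + 1)\<^sup>2" by (simp add: card_cartesian_product power2_eq_square nat_add_distrib nat_mult_distrib algebra_simps)
  also have "\<dots> \<le> (3 * Q)\<^sup>2" using Q by (intro power_mono) auto
  finally show ?thesis .
qed

text \<open>Rounding goes towards zero, not to the nearest point, so absolute values never grow and
  rounded vectors stay in the Euclidean ball.\<close>

lemma ex_real_grid_point:
  fixes t :: real
  assumes "\<bar>t\<bar> \<le> 1" "Q > 0"
  shows "\<exists>u::int. \<bar>u\<bar> \<le> int Q \<and> \<bar>of_int u / real Q\<bar> \<le> \<bar>t\<bar> \<and> \<bar>t - of_int u / real Q\<bar> \<le> 1 / real Q"
proof -
  have *: "\<exists>u::int. \<bar>u\<bar> \<le> int Q \<and> \<bar>of_int u / real Q\<bar> \<le> s \<and> \<bar>s - of_int u / real Q\<bar> \<le> 1 / real Q"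
    if s: "0 \<le> s" "s \<le> 1" for s :: real
  proof (intro exI[of _ "\<lfloor>s * real Q\<rfloor>"] conjI)
    have f: "0 \<le> \<lfloor>s * real Q\<rfloor>" "of_int \<lfloor>s * real Q\<rfloor> \<le> s * real Q" "s * real Q \<le> of_int \<lfloor>s * real Q\<rfloor> + 1"
      using s assms(2) by auto
    have "s * real Q \<le> 1 * real Q" using s by (intro mult_right_mono) auto
    with f(2) have "of_int \<lfloor>s * real Q\<rfloor> \<le> real Q" by linarith
    then show "\<bar>\<lfloor>s * real Q\<rfloor>\<bar> \<le> int Q" using f(1) by linarith
    show "\<bar>of_int \<lfloor>s * real Q\<rfloor> / real Q\<bar> \<le> s" using f assms(2) by (simp add: pos_divide_le_eq)
    have "0 \<le> s - of_int \<lfloor>s * real Q\<rfloor> / real Q" using f assms(2) by (simp add: pos_divide_le_eq)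
    moreover have "s \<le> (of_int \<lfloor>s * real Q\<rfloor> + 1) / real Q"
      using f(3) assms(2) by (simp add: pos_le_divide_eq)
    then have "s - of_int \<lfloor>s * real Q\<rfloor> / real Q \<le> 1 / real Q" by (simp add: add_divide_distrib)
    ultimately show "\<bar>s - of_int \<lfloor>s * real Q\<rfloor> / real Q\<bar> \<le> 1 / real Q" by simp
  qed
  show ?thesis
  proof (cases "t \<ge> 0")
    case True
    then show ?thesis using *[of t] assms(1) by auto
  next
    case False
    then obtain u :: int where "\<bar>u\<bar> \<le> int Q" "\<bar>of_int u / real Q\<bar> \<le> - t" "\<bar>- t - of_int u / real Q\<bar> \<le> 1 / real Q"
      using *[of "- t"] assms(1) by auto
    then show ?thesis using False by (intro exI[of _ "- u"]) auto
  qed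
qed

lemma ex_grid_point:
  assumes "norm z \<le> 1" "Q > 0"
  shows "\<exists>g\<in>grid Q. norm g \<le> norm z \<and> norm (z - g) \<le> 2 / real Q"
proof -
  have "\<bar>Re z\<bar> \<le> 1" "\<bar>Im z\<bar> \<le> 1" using assms(1) abs_Re_le_cmod abs_Im_le_cmod order_trans by blast+
  then obtain u v :: int where 
    u: "\<bar>u\<bar> \<le> int Q" "\<bar>of_int u / real Q\<bar> \<le> \<bar>Re z\<bar>" "\<bar>Re z - of_int u / real Q\<bar> \<le> 1 / real Q" and
    v: "\<bar>v\<bar> \<le> int Q" "\<bar>of_int v / real Q\<bar> \<le> \<bar>Im z\<bar>" "\<bar>Im z - of_int v / real Q\<bar> \<le> 1 / real Q"
    using ex_real_grid_point assms(2) by meson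
  define g where "g = Complex (of_int u / real Q) (of_int v / real Q)"
  have "g \<in> grid Q" unfolding grid_def g_def using u(1) v(1) by (intro image_eqI[of _ _ "(u, v)"]) auto
  moreover have "norm g \<le> norm z"
    unfolding g_def cmod_def complex.sel using u(2) v(2)
    by (intro real_sqrt_le_mono add_mono) (simp_all only: abs_le_square_iff)
  moreover have "norm (z - g) \<le> 2 / real Q"
    using cmod_le[of "z - g"] u(3) v(3) by (simp add: g_def)
  ultimately show ?thesis by blast
qed

text \<open>The variance of the random form at a test point: vectors in Euclidean balls make it at
  most 1, as \<open>ex_signs_small\<close> requires.\<close>

lemma sum_norm_prod_square:
  "(\<Sum>j\<in>multi_indices m n. (norm (\<Prod>i<m. x i (j i)))\<^sup>2) = (\<Prod>i<m. \<Sum>l<n. (norm (x i l :: complex))\<^sup>2)"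
  unfolding multi_indices_def
  by (subst prod_sum_PiE) (simp_all add: prod_norm[symmetric] prod_power_distrib)

text \<open>Random signs and a union bound over a grid of mesh \<open>n\<^sup>-\<^sup>m\<close>.\<close>

lemma ex_signs_bounded_on_euclidean_balls:
  assumes m: "m > 0" and n: "n > 0"
  shows "\<exists>A. bounded_on_lp 2 m n (\<lambda>j. of_real (sign_in A j) :: complex)
     (18 * real m * sqrt (real n * (1 + ln (real n))))"
proof -
  let ?J = "multi_indices m n"
  \<comment> \<open>There are n^m monomials, each changed by at most 2m/Q under rounding, so this
    mesh keeps the total error below the constant 2m.\<close>
  define Q where "Q = n ^ m"
  have Q: "Q > 0" using n by (simp add: Q_def)
  define Y where "Y = {y \<in> ({..<m} \<times> {..<n}) \<rightarrow>\<^sub>E grid Q. \<forall>i<m. (\<Sum>l<n. (norm (y (i, l)))\<^sup>2) \<le> 1}"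
  \<comment> \<open>The four rotations turn one-sided bounds on real parts into bounds on the
    absolute values of the real and imaginary parts.\<close>
  define Z where "Z = Y \<times> {1, - 1, \<i>, - \<i>}"
  define c where "c z j = Re (snd z * (\<Prod>i<m. fst z (i, j i)))" for z :: "(nat \<times> nat \<Rightarrow> complex) \<times> complex" and j :: "nat \<Rightarrow> nat"
  have finY: "finite (({..<m} \<times> {..<n}) \<rightarrow>\<^sub>E grid Q)" by (intro finite_PiE) auto
  then have "finite Y" unfolding Y_def by (rule finite_subset[rotated]) auto
  then have finZ: "finite Z" by (simp add: Z_def)
  have cle: "(\<Sum>j\<in>?J. (c z j)\<^sup>2) \<le> 1" if z: "z \<in> Z" for z
  proof -
    obtain y e where ye: "z = (y, e)" "y \<in> Y" "norm e = 1" using z unfolding Z_def by auto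
    have "(c z j)\<^sup>2 \<le> (norm (\<Prod>i<m. y (i, j i)))\<^sup>2" for j
    proof -
      have "\<bar>c z j\<bar> \<le> norm (e * (\<Prod>i<m. y (i, j i)))" unfolding c_def ye fst_conv snd_conv by (rule abs_Re_le_cmod)
      also have "\<dots> = norm (\<Prod>i<m. y (i, j i))" using ye by (simp add: norm_mult)
      finally show ?thesis by (simp only: abs_le_square_iff[symmetric] abs_norm_cancel)
    qed
    then have "(\<Sum>j\<in>?J. (c z j)\<^sup>2) \<le> (\<Sum>j\<in>?J. (norm (\<Prod>i<m. y (i, j i)))\<^sup>2)" by (intro sum_mono)
    also have "\<dots> = (\<Prod>i<m. \<Sum>l<n. (norm (y (i, l)))\<^sup>2)" using sum_norm_prod_square[of "\<lambda>i l. y (i, l)"] .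
    also have "\<dots> \<le> 1" using ye(2) by (intro prod_le_1) (auto simp: Y_def intro: sum_nonneg)
    finally show ?thesis .
  qed
  \<comment> \<open>The logarithm of (9Q)^(2mn): each of the mn coordinates has at most (3Q)^2 grid
    values, and the 4 rotations are absorbed by 9^(mn).\<close>
  define L where "L = 2 * real m * real n * ln (9 * real Q)"
  have L: "L > 0" using m n Q by (simp add: L_def)
  have "card Y \<le> card (({..<m} \<times> {..<n}) \<rightarrow>\<^sub>E grid Q)" by (rule card_mono[OF finY]) (auto simp: Y_def)
  also have "\<dots> = card (grid Q) ^ (m * n)" by (simp add: card_PiE card_cartesian_product)
  also have "\<dots> \<le> ((3 * Q)\<^sup>2) ^ (m * n)" by (intro power_mono card_grid_le Q) auto
  finally have Yle: "card Y \<le> ((3 * Q)\<^sup>2) ^ (m * n)" .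
  have "card Z \<le> card Y * 4" unfolding Z_def card_cartesian_product
    by (intro mult_left_mono order.trans[OF card_insert_le_m1]) (auto simp: card_insert_if)
  also have "\<dots> \<le> ((3 * Q)\<^sup>2) ^ (m * n) * (9 ^ 1)" using Yle by simp
  also have "\<dots> \<le> ((3 * Q)\<^sup>2) ^ (m * n) * 9 ^ (m * n)"
    using m n by (intro mult_left_mono power_increasing) auto
  also have "\<dots> = (9 * Q) ^ (2 * (m * n))" 
  proof -
    have "((3 * Q)\<^sup>2) ^ (m * n) * 9 ^ (m * n) = ((3 * Q)\<^sup>2 * 9) ^ (m * n)"
      by (rule power_mult_distrib[symmetric])
    also have "(3 * Q)\<^sup>2 * 9 = (9 * Q)\<^sup>2" by (simp add: power2_eq_square)
    finally show ?thesis by (simp only: power_mult)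
  qed
  finally have "real (card Z) \<le> real ((9 * Q) ^ (2 * (m * n)))" by (simp only: of_nat_le_iff)
  also have "\<dots> = exp L"
  proof -
    have "exp L = exp (real (2 * (m * n)) * ln (9 * real Q))" by (simp add: L_def mult_ac)
    also have "\<dots> = exp (ln (9 * real Q)) ^ (2 * (m * n))" by (rule exp_of_nat_mult)
    finally show ?thesis using Q by simp
  qed
  finally have cardZ: "real (card Z) \<le> exp L" .
  obtain A where A: "\<And>z. z \<in> Z \<Longrightarrow> (\<Sum>j\<in>?J. sign_in A j * c z j) \<le> 2 * sqrt L"
    using ex_signs_small[where c = c, OF finite_multi_indices finZ cle L cardZ] by blast
  define a where "a j = (of_real (sign_in A j) :: complex)" for j
  define R where "R = sqrt (real n * (1 + ln (real n)))"
  have lnn: "ln (real n) \<ge> 0" using n by simp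
  have R1: "R \<ge> 1"
  proof -
    have "1 * 1 \<le> real n * (1 + ln (real n))" using n lnn by (intro mult_mono) auto
    then show ?thesis by (simp add: R_def)
  qed
  have sqrtL: "sqrt L \<le> 4 * real m * R"
  proof -
    have "ln (9 * real Q) = ln 9 + real m * ln (real n)"
      using n by (simp add: Q_def ln_mult ln_realpow)
    also have "\<dots> \<le> 8 * real m * (1 + ln (real n))"
    proof -
      have "ln (9::real) \<le> 8" using ln_le_minus_one[of "9::real"] by simp
      also have "8 \<le> 8 * real m" using m by simp
      finally have "ln 9 \<le> 8 * real m" .
      moreover have "real m * ln (real n) \<le> 8 * real m * ln (real n)" using lnn by (intro mult_right_mono) auto
      ultimately show ?thesis by (simp add: distrib_left)
    qed
    finally have "L \<le> 2 * real m * real n * (8 * real m * (1 + ln (real n)))"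
      unfolding L_def by (intro mult_left_mono) auto
    also have "\<dots> = (4 * real m * R)\<^sup>2"
      using lnn by (simp add: R_def power_mult_distrib) (simp add: power2_eq_square)
    finally show ?thesis using R1 by (intro real_le_lsqrt) auto
  qed
  have grid_bound: "norm (coeff_form m n a (\<lambda>i l. y (i, l))) \<le> 16 * real m * R" if y: "y \<in> Y" for y
  proof -
    define F where "F = coeff_form m n a (\<lambda>i l. y (i, l))"
    have Fe: "Re (e * F) \<le> 2 * sqrt L" if e: "e \<in> {1, - 1, \<i>, - \<i>}" for e
    proof -
      have "Re (e * F) = (\<Sum>j\<in>?J. Re (e * (a j * (\<Prod>i<m. y (i, j i)))))"
        by (simp only: F_def coeff_form_def sum_distrib_left Re_sum)
      also have "\<dots> = (\<Sum>j\<in>?J. sign_in A j * c (y, e) j)"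
      proof (rule sum.cong)
        fix j
        have "e * (a j * (\<Prod>i<m. y (i, j i))) = of_real (sign_in A j) * (e * (\<Prod>i<m. y (i, j i)))"
          by (simp add: a_def)
        then show "Re (e * (a j * (\<Prod>i<m. y (i, j i)))) = sign_in A j * c (y, e) j"
          unfolding c_def fst_conv snd_conv by (simp only: scaleR_conv_of_real[symmetric] scaleR_complex.sel)
      qed simp
      also have "\<dots> \<le> 2 * sqrt L" using A[of "(y, e)"] y e by (simp only: Z_def) blast
      finally show ?thesis .
    qed
    have "\<bar>Re F\<bar> \<le> 2 * sqrt L" using Fe[of 1] Fe[of "- 1"] by simp
    moreover have "\<bar>Im F\<bar> \<le> 2 * sqrt L" using Fe[of \<i>] Fe[of "- \<i>"] by simp
    ultimately have "norm F \<le> 4 * sqrt L" using cmod_le[of F] by linarith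
    also have "\<dots> \<le> 4 * (4 * real m * R)" by (intro mult_left_mono sqrtL) simp
    finally show ?thesis by (simp add: F_def)
  qed
  \<comment> \<open>The constant 18 is 16 from the grid points plus 2 from rounding, where
    \<open>R \<ge> 1\<close> absorbs the additive error.\<close>
  have "norm (coeff_form m n a x) \<le> 18 * real m * R" if x: "\<forall>i<m. (\<Sum>l<n. norm (x i l) powr 2) \<le> 1" for x
  proof -
    have nx: "norm (x i l) \<le> 1" if "i < m" "l < n" for i l
      by (rule norm_le_1_if_sum_powr_le_1[of "x i" 2 n]) (use x that in auto)
    then have "\<forall>i l. i < m \<and> l < n \<longrightarrow> (\<exists>g\<in>grid Q. norm g \<le> norm (x i l) \<and> norm (x i l - g) \<le> 2 / real Q)"
      using ex_grid_point Q by blast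
    then obtain g where g: "\<And>i l. i < m \<Longrightarrow> l < n \<Longrightarrow> 
        g i l \<in> grid Q \<and> norm (g i l) \<le> norm (x i l) \<and> norm (x i l - g i l) \<le> 2 / real Q"
      by metis
    define y where "y = (\<lambda>(i, l)\<in>{..<m} \<times> {..<n}. g i l)"
    have "(\<Sum>l<n. (norm (y (i, l)))\<^sup>2) \<le> 1" if "i < m" for i
    proof -
      have "(\<Sum>l<n. (norm (y (i, l)))\<^sup>2) \<le> (\<Sum>l<n. norm (x i l) powr 2)"
        using g that by (intro sum_mono) (simp add: y_def power_mono)
      then show ?thesis using x that by force
    qed
    then have "y \<in> Y" unfolding Y_def y_def using g by auto
    have "norm (coeff_form m n a x - coeff_form m n a (\<lambda>i l. y (i, l)))
       = norm (\<Sum>j\<in>?J. a j * ((\<Prod>i<m. x i (j i)) - (\<Prod>i<m. y (i, j i))))"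
      by (simp add: coeff_form_def sum_subtractf right_diff_distrib)
    also have "\<dots> \<le> (\<Sum>j\<in>?J. 2 * real m / real Q)"
    proof (rule sum_norm_le)
      fix j assume j: "j \<in> ?J"
      have "norm (a j * ((\<Prod>i<m. x i (j i)) - (\<Prod>i<m. y (i, j i)))) = norm ((\<Prod>i<m. x i (j i)) - (\<Prod>i<m. y (i, j i)))"
        by (simp add: norm_mult a_def sign_in_def)
      also have "\<dots> \<le> (\<Sum>i<m. norm (x i (j i) - y (i, j i)))"
      proof (rule norm_prod_diff)
        fix i assume "i \<in> {..<m}"
        then have i: "i < m" "j i < n" using multi_indices_less[OF j] by auto
        show "norm (x i (j i)) \<le> 1" using nx[OF i] .
        then show "norm (y (i, j i)) \<le> 1" using g[OF i] i by (simp add: y_def)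
      qed
      also have "\<dots> \<le> (\<Sum>i<m. 2 / real Q)"
        using g multi_indices_less[OF j] by (intro sum_mono) (simp add: y_def)
      also have "\<dots> = 2 * real m / real Q" by simp
      finally show "norm (a j * ((\<Prod>i<m. x i (j i)) - (\<Prod>i<m. y (i, j i)))) \<le> 2 * real m / real Q" .
    qed
    also have "\<dots> = 2 * real m" using Q by (simp add: multi_indices_def card_PiE Q_def)
    also have "\<dots> \<le> 2 * real m * R" using R1 m by simp
    finally have "norm (coeff_form m n a x) \<le> norm (coeff_form m n a (\<lambda>i l. y (i, l))) + 2 * real m * R"
      using norm_triangle_sub[of "coeff_form m n a x" "coeff_form m n a (\<lambda>i l. y (i, l))"] by linarith
    with grid_bound[OF \<open>y \<in> Y\<close>] show ?thesis by linarith
  qed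
  then show ?thesis unfolding bounded_on_lp_def R_def a_def by blast
qed

lemma ex_flat_complex_form:
  assumes "m > 0" "n > 0"
  shows "\<exists>a :: (nat \<Rightarrow> nat) \<Rightarrow> complex. (\<forall>j. norm (a j) = 1) \<and>
      bounded_on_lp 2 m n a (18 * real m * sqrt (real n * (1 + ln (real n))))"
  using ex_signs_bounded_on_euclidean_balls[OF assms] by (force simp: sign_in_def)

text \<open>The signs found in the complex case are real already; restricting that form to real
  vectors can only shrink its norm.\<close>

lemma ex_flat_real_form:
  assumes "m > 0" "n > 0"
  shows "\<exists>a :: (nat \<Rightarrow> nat) \<Rightarrow> real. (\<forall>j. norm (a j) = 1) \<and>
      bounded_on_lp 2 m n a (18 * real m * sqrt (real n * (1 + ln (real n))))"
proof -
  obtain A where A: "bounded_on_lp 2 m n (\<lambda>j. of_real (sign_in A j) :: complex)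
     (18 * real m * sqrt (real n * (1 + ln (real n))))"
    using ex_signs_bounded_on_euclidean_balls[OF assms] by blast
  have "bounded_on_lp 2 m n (sign_in A) (18 * real m * sqrt (real n * (1 + ln (real n))))"
    unfolding bounded_on_lp_def
  proof (intro allI impI)
    fix x :: "nat \<Rightarrow> nat \<Rightarrow> real" assume "\<forall>i<m. (\<Sum>l<n. norm (x i l) powr 2) \<le> 1"
    then have "norm (coeff_form m n (\<lambda>j. of_real (sign_in A j) :: complex) (\<lambda>i l. of_real (x i l)))
        \<le> 18 * real m * sqrt (real n * (1 + ln (real n)))"
      using A by (simp add: bounded_on_lp_def)
    also have "coeff_form m n (\<lambda>j. of_real (sign_in A j) :: complex) (\<lambda>i l. of_real (x i l))
        = of_real (coeff_form m n (sign_in A) x)"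
      by (simp add: coeff_form_def)
    finally show "norm (coeff_form m n (sign_in A) x) \<le> 18 * real m * sqrt (real n * (1 + ln (real n)))"
      by simp
  qed
  then show ?thesis by (intro exI[of _ "sign_in A"]) (simp add: sign_in_def)
qed

text \<open>Stated for an abstract scalar field, so that real and complex scalars differ only in the
  flat forms supplied for the lower bounds. Both ranges of p lie below 2m, as the upper estimates
  require.\<close>

lemma estimates_of_flat_forms:
  assumes m: "m \<ge> 2"
    and ex: "\<And>n. n > 0 \<Longrightarrow> \<exists>a :: (nat \<Rightarrow> nat) \<Rightarrow> 'k::{real_normed_field, real_inner}.
      (\<forall>j. norm (a j) = 1) \<and> bounded_on_lp 2 m n a (C * sqrt (real n * (1 + ln (real n))))"
  shows "1 \<le> r \<and> r \<le> 2 \<and> 1 \<le> p \<and> p < 2 \<longrightarrow>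
      (\<exists>D>0. coeff_estimate TYPE('k) m r p ((2 * real m * r + 2 * real m * p - real m * p * r - p * r) / (2 * p * r)) D) \<and>
      optimal_exponent_ge TYPE('k) m r p ((2 * real m - r) / (2 * r))" (is ?a)
    and "2 < r \<and> 1 \<le> p \<and> p \<le> real m \<longrightarrow>
      (\<exists>D>0.
         (p > 2 \<longrightarrow> (\<forall>\<epsilon>>0. coeff_estimate TYPE('k) m r p ((2 * real m - p + \<epsilon>) / (p * r)) D)) \<and>
         (p = 2 \<longrightarrow> coeff_estimate TYPE('k) m r p ((2 * real m - p) / (p * r)) D)) \<and>
      (2 \<le> p \<longrightarrow> optimal_exponent_ge TYPE('k) m r p
         ((2 * real m * r + 2 * real m * p - real m * p * r - p * r) / (2 * p * r))) \<and>
      (p \<le> 2 \<longrightarrow> optimal_exponent_ge TYPE('k) m r p ((2 * real m - r) / (2 * r)))" (is ?b)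
proof -
  show ?a
    using coeff_estimate_small_r[OF m, of r p, where ?'k = 'k] m
      optimal_exponent_ge_of_euclidean_bound(1)[OF ex, of r p] by auto
  show ?b
  proof
    assume rp: "2 < r \<and> 1 \<le> p \<and> p \<le> real m"
    then obtain D where D: "D > 0"
      "\<And>\<epsilon>. \<epsilon> \<ge> 0 \<Longrightarrow> coeff_estimate TYPE('k) m r p ((2 * real m - p + \<epsilon>) / (p * r)) D"
      using coeff_estimate_large_r[OF m, of r p, where ?'k = 'k] by auto
    have "\<exists>D>0.
         (p > 2 \<longrightarrow> (\<forall>\<epsilon>>0. coeff_estimate TYPE('k) m r p ((2 * real m - p + \<epsilon>) / (p * r)) D)) \<and>
         (p = 2 \<longrightarrow> coeff_estimate TYPE('k) m r p ((2 * real m - p) / (p * r)) D)"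
      using D(1) D(2)[of 0] D(2) by (intro exI[of _ D]) auto
    then show "(\<exists>D>0.
         (p > 2 \<longrightarrow> (\<forall>\<epsilon>>0. coeff_estimate TYPE('k) m r p ((2 * real m - p + \<epsilon>) / (p * r)) D)) \<and>
         (p = 2 \<longrightarrow> coeff_estimate TYPE('k) m r p ((2 * real m - p) / (p * r)) D)) \<and>
      (2 \<le> p \<longrightarrow> optimal_exponent_ge TYPE('k) m r p
         ((2 * real m * r + 2 * real m * p - real m * p * r - p * r) / (2 * p * r))) \<and>
      (p \<le> 2 \<longrightarrow> optimal_exponent_ge TYPE('k) m r p ((2 * real m - r) / (2 * r)))"
      using optimal_exponent_ge_of_euclidean_bound[OF ex, of r p] rp by simp
  qed
qed

theorem proposition3p1:
  fixes m :: nat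
  assumes "m \<ge> 2"
  shows
    "(\<comment> \<open>real scalars\<close>
       (\<forall>(r::real) (p::real). 1 \<le> r \<and> r \<le> 2 \<and> 1 \<le> p \<and> p < 2 \<longrightarrow>
          (\<exists>D>0. coeff_estimate TYPE(real) m r p ((2 * real m * r + 2 * real m * p - real m * p * r - p * r) / (2 * p * r)) D) \<and>
          optimal_exponent_ge TYPE(real) m r p ((2 * real m - r) / (2 * r))) \<and>
       (\<forall>(r::real) (p::real). 2 < r \<and> 1 \<le> p \<and> p \<le> real m \<longrightarrow>
          (\<exists>D>0.
             (p > 2 \<longrightarrow> (\<forall>\<epsilon>>0. coeff_estimate TYPE(real) m r p ((2 * real m - p + \<epsilon>) / (p * r)) D)) \<and>
             (p = 2 \<longrightarrow> coeff_estimate TYPE(real) m r p ((2 * real m - p) / (p * r)) D)) \<and>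
          (2 \<le> p \<longrightarrow> optimal_exponent_ge TYPE(real) m r p
             ((2 * real m * r + 2 * real m * p - real m * p * r - p * r) / (2 * p * r))) \<and>
          (p \<le> 2 \<longrightarrow> optimal_exponent_ge TYPE(real) m r p ((2 * real m - r) / (2 * r))))) \<and>
     (\<comment> \<open>complex scalars\<close>
       (\<forall>(r::real) (p::real). 1 \<le> r \<and> r \<le> 2 \<and> 1 \<le> p \<and> p < 2 \<longrightarrow>
          (\<exists>D>0. coeff_estimate TYPE(complex) m r p ((2 * real m * r + 2 * real m * p - real m * p * r - p * r) / (2 * p * r)) D) \<and>
          optimal_exponent_ge TYPE(complex) m r p ((2 * real m - r) / (2 * r))) \<and>
       (\<forall>(r::real) (p::real). 2 < r \<and> 1 \<le> p \<and> p \<le> real m \<longrightarrow>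
          (\<exists>D>0.
             (p > 2 \<longrightarrow> (\<forall>\<epsilon>>0. coeff_estimate TYPE(complex) m r p ((2 * real m - p + \<epsilon>) / (p * r)) D)) \<and>
             (p = 2 \<longrightarrow> coeff_estimate TYPE(complex) m r p ((2 * real m - p) / (p * r)) D)) \<and>
          (2 \<le> p \<longrightarrow> optimal_exponent_ge TYPE(complex) m r p
             ((2 * real m * r + 2 * real m * p - real m * p * r - p * r) / (2 * p * r))) \<and>
          (p \<le> 2 \<longrightarrow> optimal_exponent_ge TYPE(complex) m r p ((2 * real m - r) / (2 * r)))))"
proof -
  have "m > 0" using assms by simp
  note real = estimates_of_flat_forms[OF assms ex_flat_real_form[OF this]]
  note complex = estimates_of_flat_forms[OF assms ex_flat_complex_form[OF \<open>m > 0\<close>]]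
  show ?thesis by (intro conjI allI; rule real complex)
qed

end
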